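(* Let $G$ be a Lie group which acts on the exact symplectic manifold $(M,\omega=-d\theta)$ leaving the $1$-form $\theta$ invariant, and let $H$ and $f$ be smooth, $G$-invariant functions on $M$. Denote by $J:M\to\mathfrak g^*$ the associated $G$-equivariant momentum map. Then the conformal Hamiltonian vector field $X^f_H$ with Hamiltonian $H$ and conformal parameter $f$ is a $G$-invariant vector field, and its flow preserves the ray pre-images of the associated momentum map as follows: $$J(x(t))=e^{\int_0^t -f(x(s))\,ds}\,J(x(0)),$$ for any integral curve $x$ of $X^f_H$ and any time $t$.
   Context: The momentum map is $\langle J(x),\xi\rangle=\theta(\xi_M)(x)$ for $x\in M$, $\xi\in\mathfrak g$, with $\xi_M$ the infinitesimal generator of $\xi$. A vector field $X^f_H$ on $(M,\omega=-d\theta)$ is conformal Hamiltonian with conformal parameter the smooth function $f$ and smooth Hamiltonian $H$ if $i_{X^f_H}\omega=dH-f\theta$. Ray pre-images are the sets $J^{-1}(\mathbb R^+\mu)$ with $\mathbb R^+\mu=\{r\mu:r>0\}$, $\mu\in\mathfrak g^*$.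
   Formalization: The sign in the exponent is corrected: with ω = -dθ and i_X ω = dH - fθ, one has J(x(t)) = exp(∫_0^t f(x(s)) ds) J(x(0)); the stated sign -f fails for θ = p dq on R², H = 0, f = 1, G = R translating q. *)

theory Defs
  imports "HOL-Analysis.Analysis" "HOL-Algebra.Group_Action"
begin

section \<open>Smooth maps between finite-dimensional normed spaces\<close>

text \<open>
  \<open>Ck_on k S f\<close> is intended for open \<open>S\<close>. On a finite-dimensional domain,
  continuity of all iterated directional derivatives is the usual notion of being of class
  \<open>C\<^sup>k\<close>.
\<close>

primrec Ck_on ::
  "nat \<Rightarrow> 'a::real_normed_vector set \<Rightarrow> ('a \<Rightarrow> 'b::real_normed_vector) \<Rightarrow> bool" where
  "Ck_on 0 S f \<longleftrightarrow> continuous_on S f"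
| "Ck_on (Suc k) S f \<longleftrightarrow>
     (\<forall>x\<in>S. f differentiable (at x)) \<and>
     (\<forall>v. Ck_on k S (\<lambda>x. frechet_derivative f (at x) v))"

definition smooth_on :: "'a::real_normed_vector set \<Rightarrow> ('a \<Rightarrow> 'b::real_normed_vector) \<Rightarrow> bool" where
  "smooth_on S f \<longleftrightarrow> (\<forall>k. Ck_on k S f)"


section \<open>Smooth manifolds\<close>

text \<open>
  A chart is a pair of a domain \<open>U\<close> and a coordinate map; the coordinate map is only
  meaningful on \<open>U\<close>. The model space is a finite-dimensional normed space rather than a type
  of class \<open>euclidean_space\<close>, because the latter excludes dimension \<open>0\<close> and
  thereby discrete Lie groups.
\<close>

type_synonym ('a, 'e) chart = "'a set \<times> ('a \<Rightarrow> 'e)"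

record ('a, 'e) mfd =
  topol :: "'a topology"
  atlas :: "('a, 'e) chart set"

abbreviation points :: "('a, 'e) mfd \<Rightarrow> 'a set" where
  "points M \<equiv> topspace (topol M)"

abbreviation chart_inv :: "('a, 'e) chart \<Rightarrow> 'e \<Rightarrow> 'a" where
  "chart_inv c \<equiv> inv_into (fst c) (snd c)"

definition charts_at :: "('a, 'e) mfd \<Rightarrow> 'a \<Rightarrow> ('a, 'e) chart set" where
  "charts_at M p = {c \<in> atlas M. p \<in> fst c}"

definition some_chart :: "('a, 'e) mfd \<Rightarrow> 'a \<Rightarrow> ('a, 'e) chart" where
  "some_chart M p = (SOME c. c \<in> charts_at M p)"

locale smooth_manifold =
  fixes M :: "('a, 'e::real_normed_vector) mfd"
  assumes finite_dimensional: "\<exists>B :: 'e set. finite B \<and> span B = UNIV"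
    and Hausdorff: "Hausdorff_space (topol M)"
    and second_countable: "second_countable (topol M)"
    and charts_cover: "(\<Union>c\<in>atlas M. fst c) = points M"
    and chart_domain_open: "c \<in> atlas M \<Longrightarrow> openin (topol M) (fst c)"
    and chart_image_open: "c \<in> atlas M \<Longrightarrow> open (snd c ` fst c)"
    and chart_homeomorphism: "c \<in> atlas M \<Longrightarrow>
      homeomorphic_map (subtopology (topol M) (fst c)) (top_of_set (snd c ` fst c)) (snd c)"
    and charts_compatible: "c \<in> atlas M \<Longrightarrow> d \<in> atlas M \<Longrightarrow>
      smooth_on (snd c ` (fst c \<inter> fst d)) (snd d \<circ> chart_inv c)"

definition smooth_map ::
  "('a, 'e::real_normed_vector) mfd \<Rightarrow> ('b, 'f::real_normed_vector) mfd \<Rightarrow> ('a \<Rightarrow> 'b) \<Rightarrow> bool" where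
  "smooth_map M N F \<longleftrightarrow>
     continuous_map (topol M) (topol N) F \<and>
     (\<forall>c\<in>atlas M. \<forall>d\<in>atlas N.
        smooth_on (snd c ` {p \<in> fst c. F p \<in> fst d}) (snd d \<circ> F \<circ> chart_inv c))"

definition smooth_function :: "('a, 'e::real_normed_vector) mfd \<Rightarrow> ('a \<Rightarrow> real) \<Rightarrow> bool" where
  "smooth_function M h \<longleftrightarrow> (\<forall>c\<in>atlas M. smooth_on (snd c ` fst c) (h \<circ> chart_inv c))"

definition prod_mfd :: "('a, 'e) mfd \<Rightarrow> ('b, 'f) mfd \<Rightarrow> ('a \<times> 'b, 'e \<times> 'f) mfd" where
  "prod_mfd M N = \<lparr>topol = prod_topology (topol M) (topol N),
     atlas = {(fst c \<times> fst d, map_prod (snd c) (snd d)) |c d. c \<in> atlas M \<and> d \<in> atlas N}\<rparr>"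


section \<open>Tangent vectors, differentials, vector fields\<close>

text \<open>
  A tangent vector at \<open>p\<close> is given by its components in all charts around \<open>p\<close>, related
  by the Jacobians of the coordinate changes; components in other charts are set to \<open>0\<close>, so that
  equality of tangent vectors is equality of functions.
\<close>

type_synonym ('a, 'e) tvec = "('a, 'e) chart \<Rightarrow> 'e"

definition tangent_space :: "('a, 'e::real_normed_vector) mfd \<Rightarrow> 'a \<Rightarrow> ('a, 'e) tvec set" where
  "tangent_space M p = {v.
     (\<forall>c. c \<notin> charts_at M p \<longrightarrow> v c = 0) \<and>
     (\<forall>c\<in>charts_at M p. \<forall>d\<in>charts_at M p.
        v d = frechet_derivative (snd d \<circ> chart_inv c) (at (snd c p)) (v c))}"

text \<open>The tangent vector at \<open>p\<close> whose components in the chart \<open>c\<close> are \<open>w\<close>.\<close>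

definition coord_tvec ::
  "('a, 'e::real_normed_vector) mfd \<Rightarrow> ('a, 'e) chart \<Rightarrow> 'a \<Rightarrow> 'e \<Rightarrow> ('a, 'e) tvec" where
  "coord_tvec M c p w = (\<lambda>d. if d \<in> charts_at M p
     then frechet_derivative (snd d \<circ> chart_inv c) (at (snd c p)) w else 0)"

text \<open>
  The use of a chosen chart below is harmless: for smooth manifolds and smooth objects
  the values on tangent vectors do not depend on the chart.
\<close>

definition tangent_map ::
  "('a, 'e::real_normed_vector) mfd \<Rightarrow> ('b, 'f::real_normed_vector) mfd \<Rightarrow> ('a \<Rightarrow> 'b) \<Rightarrow>
     'a \<Rightarrow> ('a, 'e) tvec \<Rightarrow> ('b, 'f) tvec" where
  "tangent_map M N F p v = (\<lambda>d. if d \<in> charts_at N (F p)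
     then let c = some_chart M p
          in frechet_derivative (snd d \<circ> F \<circ> chart_inv c) (at (snd c p)) (v c)
     else 0)"

definition differential ::
  "('a, 'e::real_normed_vector) mfd \<Rightarrow> ('a \<Rightarrow> real) \<Rightarrow> 'a \<Rightarrow> ('a, 'e) tvec \<Rightarrow> real" where
  "differential M h p v =
     (let c = some_chart M p
      in frechet_derivative (h \<circ> chart_inv c) (at (snd c p)) (v c))"

definition smooth_vector_field ::
  "('a, 'e::real_normed_vector) mfd \<Rightarrow> ('a \<Rightarrow> ('a, 'e) tvec) \<Rightarrow> bool" where
  "smooth_vector_field M X \<longleftrightarrow>
     (\<forall>p\<in>points M. X p \<in> tangent_space M p) \<and>
     (\<forall>c\<in>atlas M. smooth_on (snd c ` fst c) (\<lambda>y. X (chart_inv c y) c))"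

definition integral_curve ::
  "('a, 'e::real_normed_vector) mfd \<Rightarrow> ('a \<Rightarrow> ('a, 'e) tvec) \<Rightarrow> real set \<Rightarrow> (real \<Rightarrow> 'a) \<Rightarrow> bool" where
  "integral_curve M X I x \<longleftrightarrow>
     open I \<and> is_interval I \<and>
     continuous_map (top_of_set I) (topol M) x \<and>
     (\<forall>t\<in>I. \<forall>c\<in>charts_at M (x t).
        ((\<lambda>s. snd c (x s)) has_vector_derivative X (x t) c) (at t))"


section \<open>One-forms and exact symplectic manifolds\<close>

text \<open>
  Covectors are extended by \<open>undefined\<close> outside the tangent space, so that equality of covectors
  is equality of functions.
\<close>

definition cotangent_space ::
  "('a, 'e::real_normed_vector) mfd \<Rightarrow> 'a \<Rightarrow> (('a, 'e) tvec \<Rightarrow> real) set" where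
  "cotangent_space M p = {\<alpha> \<in> extensional (tangent_space M p).
     \<forall>u\<in>tangent_space M p. \<forall>v\<in>tangent_space M p. \<forall>a b.
       \<alpha> (\<lambda>c. a *\<^sub>R u c + b *\<^sub>R v c) = a * \<alpha> u + b * \<alpha> v}"

definition covec_scale ::
  "('a, 'e::real_normed_vector) mfd \<Rightarrow> 'a \<Rightarrow> real \<Rightarrow> (('a, 'e) tvec \<Rightarrow> real) \<Rightarrow>
     (('a, 'e) tvec \<Rightarrow> real)" where
  "covec_scale M p r \<alpha> = (\<lambda>u\<in>tangent_space M p. r * \<alpha> u)"

definition smooth_one_form ::
  "('a, 'e::real_normed_vector) mfd \<Rightarrow> ('a \<Rightarrow> ('a, 'e) tvec \<Rightarrow> real) \<Rightarrow> bool" where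
  "smooth_one_form M \<theta> \<longleftrightarrow>
     (\<forall>p\<in>points M. \<theta> p \<in> cotangent_space M p) \<and>
     (\<forall>c\<in>atlas M. \<forall>w. smooth_on (snd c ` fst c)
        (\<lambda>y. \<theta> (chart_inv c y) (coord_tvec M c (chart_inv c y) w)))"

text \<open>
  In local coordinates this is
  \<open>d\<theta> = \<Sum>\<^bsub>i,j\<^esub> (\<partial>\<^sub>i \<theta>\<^sub>j) dx\<^sup>i \<and> dx\<^sup>j\<close>, normalized such that
  \<open>d\<theta>(X,Y) = X(\<theta>(Y)) - Y(\<theta>(X)) - \<theta>([X,Y])\<close>.
\<close>

definition exterior_derivative ::
  "('a, 'e::real_normed_vector) mfd \<Rightarrow> ('a \<Rightarrow> ('a, 'e) tvec \<Rightarrow> real) \<Rightarrow>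
     'a \<Rightarrow> ('a, 'e) tvec \<Rightarrow> ('a, 'e) tvec \<Rightarrow> real" where
  "exterior_derivative M \<theta> p u v =
     (let c = some_chart M p;
          \<theta>\<^sub>c = (\<lambda>w y. \<theta> (chart_inv c y) (coord_tvec M c (chart_inv c y) w))
      in frechet_derivative (\<theta>\<^sub>c (v c)) (at (snd c p)) (u c)
         - frechet_derivative (\<theta>\<^sub>c (u c)) (at (snd c p)) (v c))"

text \<open>Closedness of \<open>\<omega>\<close> is automatic from \<open>\<omega> = -d\<theta>\<close>.\<close>

definition exact_symplectic ::
  "('a, 'e::real_normed_vector) mfd \<Rightarrow> ('a \<Rightarrow> ('a, 'e) tvec \<Rightarrow> real) \<Rightarrow>
     ('a \<Rightarrow> ('a, 'e) tvec \<Rightarrow> ('a, 'e) tvec \<Rightarrow> real) \<Rightarrow> bool" where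
  "exact_symplectic M \<theta> \<omega> \<longleftrightarrow>
     smooth_manifold M \<and> smooth_one_form M \<theta> \<and>
     (\<forall>p\<in>points M. \<forall>u\<in>tangent_space M p. \<forall>v\<in>tangent_space M p.
        \<omega> p u v = - exterior_derivative M \<theta> p u v) \<and>
     (\<forall>p\<in>points M. \<forall>u\<in>tangent_space M p.
        (\<forall>v\<in>tangent_space M p. \<omega> p u v = 0) \<longrightarrow> u = (\<lambda>_. 0))"

definition interior_product ::
  "('a \<Rightarrow> ('a, 'e) tvec) \<Rightarrow> ('a \<Rightarrow> ('a, 'e) tvec \<Rightarrow> ('a, 'e) tvec \<Rightarrow> real) \<Rightarrow>
     'a \<Rightarrow> ('a, 'e) tvec \<Rightarrow> real" where
  "interior_product X \<omega> p v = \<omega> p (X p) v"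

definition conformal_Hamiltonian_vf ::
  "('a, 'e::real_normed_vector) mfd \<Rightarrow> ('a \<Rightarrow> ('a, 'e) tvec \<Rightarrow> real) \<Rightarrow>
     ('a \<Rightarrow> ('a, 'e) tvec \<Rightarrow> ('a, 'e) tvec \<Rightarrow> real) \<Rightarrow> ('a \<Rightarrow> real) \<Rightarrow> ('a \<Rightarrow> real) \<Rightarrow>
     ('a \<Rightarrow> ('a, 'e) tvec) \<Rightarrow> bool" where
  "conformal_Hamiltonian_vf M \<theta> \<omega> f H X \<longleftrightarrow>
     smooth_function M f \<and> smooth_function M H \<and> smooth_vector_field M X \<and>
     (\<forall>p\<in>points M. \<forall>v\<in>tangent_space M p.
        interior_product X \<omega> p v = differential M H p v - f p * \<theta> p v)"


section \<open>Lie groups, smooth actions and momentum maps\<close>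

locale lie_group =
  fixes \<G> :: "'g monoid" and G :: "('g, 'h::real_normed_vector) mfd"
  assumes is_group: "group \<G>"
    and is_manifold: "smooth_manifold G"
    and carrier_eq_points: "carrier \<G> = points G"
    and smooth_mult: "smooth_map (prod_mfd G G) G (\<lambda>(g, h). g \<otimes>\<^bsub>\<G>\<^esub> h)"
    and smooth_inv: "smooth_map G G (\<lambda>g. inv\<^bsub>\<G>\<^esub> g)"

text \<open>
  \<^locale>\<open>group_action\<close> requires each \<open>\<Phi> g\<close> to be \<open>undefined\<close> outside of \<open>points M\<close>.
\<close>

definition smooth_action ::
  "'g monoid \<Rightarrow> ('g, 'h::real_normed_vector) mfd \<Rightarrow> ('a, 'e::real_normed_vector) mfd \<Rightarrow>
     ('g \<Rightarrow> 'a \<Rightarrow> 'a) \<Rightarrow> bool" where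
  "smooth_action \<G> G M \<Phi> \<longleftrightarrow>
     group_action \<G> (points M) \<Phi> \<and> smooth_map (prod_mfd G M) M (\<lambda>(g, p). \<Phi> g p)"

definition invariant_function :: "'g monoid \<Rightarrow> ('a, 'e) mfd \<Rightarrow> ('g \<Rightarrow> 'a \<Rightarrow> 'a) \<Rightarrow> ('a \<Rightarrow> real) \<Rightarrow> bool" where
  "invariant_function \<G> M \<Phi> h \<longleftrightarrow> (\<forall>g\<in>carrier \<G>. \<forall>p\<in>points M. h (\<Phi> g p) = h p)"

definition invariant_one_form ::
  "'g monoid \<Rightarrow> ('a, 'e::real_normed_vector) mfd \<Rightarrow> ('g \<Rightarrow> 'a \<Rightarrow> 'a) \<Rightarrow>
     ('a \<Rightarrow> ('a, 'e) tvec \<Rightarrow> real) \<Rightarrow> bool" where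
  "invariant_one_form \<G> M \<Phi> \<theta> \<longleftrightarrow>
     (\<forall>g\<in>carrier \<G>. \<forall>p\<in>points M. \<forall>v\<in>tangent_space M p.
        \<theta> (\<Phi> g p) (tangent_map M M (\<Phi> g) p v) = \<theta> p v)"

definition invariant_vector_field ::
  "'g monoid \<Rightarrow> ('a, 'e::real_normed_vector) mfd \<Rightarrow> ('g \<Rightarrow> 'a \<Rightarrow> 'a) \<Rightarrow>
     ('a \<Rightarrow> ('a, 'e) tvec) \<Rightarrow> bool" where
  "invariant_vector_field \<G> M \<Phi> X \<longleftrightarrow>
     (\<forall>g\<in>carrier \<G>. \<forall>p\<in>points M. tangent_map M M (\<Phi> g) p (X p) = X (\<Phi> g p))"

text \<open>
  The Lie algebra of \<open>G\<close> is the tangent space at the unit (its bracket plays no role here), and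
  \<open>\<xi>\<^sub>M(p) = T\<^sub>1\<Phi>\<^sup>p(\<xi>)\<close> for the orbit map \<open>\<Phi>\<^sup>p(g) = \<Phi>\<^sub>g(p)\<close>, that is, the velocity at \<open>0\<close> of
  \<open>t \<mapsto> exp(t\<xi>)\<cdot>p\<close>.
\<close>

abbreviation lie_algebra :: "'g monoid \<Rightarrow> ('g, 'h::real_normed_vector) mfd \<Rightarrow> ('g, 'h) tvec set" where
  "lie_algebra \<G> G \<equiv> tangent_space G \<one>\<^bsub>\<G>\<^esub>"

abbreviation lie_algebra_dual ::
  "'g monoid \<Rightarrow> ('g, 'h::real_normed_vector) mfd \<Rightarrow> (('g, 'h) tvec \<Rightarrow> real) set" where
  "lie_algebra_dual \<G> G \<equiv> cotangent_space G \<one>\<^bsub>\<G>\<^esub>"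

abbreviation dual_scale ::
  "'g monoid \<Rightarrow> ('g, 'h::real_normed_vector) mfd \<Rightarrow> real \<Rightarrow> (('g, 'h) tvec \<Rightarrow> real) \<Rightarrow>
     (('g, 'h) tvec \<Rightarrow> real)" where
  "dual_scale \<G> G \<equiv> covec_scale G \<one>\<^bsub>\<G>\<^esub>"

definition infinitesimal_generator ::
  "'g monoid \<Rightarrow> ('g, 'h::real_normed_vector) mfd \<Rightarrow> ('a, 'e::real_normed_vector) mfd \<Rightarrow>
     ('g \<Rightarrow> 'a \<Rightarrow> 'a) \<Rightarrow> ('g, 'h) tvec \<Rightarrow> 'a \<Rightarrow> ('a, 'e) tvec" where
  "infinitesimal_generator \<G> G M \<Phi> \<xi> p = tangent_map G M (\<lambda>g. \<Phi> g p) \<one>\<^bsub>\<G>\<^esub> \<xi>"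

definition momentum_map ::
  "'g monoid \<Rightarrow> ('g, 'h::real_normed_vector) mfd \<Rightarrow> ('a, 'e::real_normed_vector) mfd \<Rightarrow>
     ('g \<Rightarrow> 'a \<Rightarrow> 'a) \<Rightarrow> ('a \<Rightarrow> ('a, 'e) tvec \<Rightarrow> real) \<Rightarrow> 'a \<Rightarrow> (('g, 'h) tvec \<Rightarrow> real)" where
  "momentum_map \<G> G M \<Phi> \<theta> p =
     (\<lambda>\<xi>\<in>lie_algebra \<G> G. \<theta> p (infinitesimal_generator \<G> G M \<Phi> \<xi> p))"

definition ray ::
  "'g monoid \<Rightarrow> ('g, 'h::real_normed_vector) mfd \<Rightarrow> (('g, 'h) tvec \<Rightarrow> real) \<Rightarrow>
     (('g, 'h) tvec \<Rightarrow> real) set" where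
  "ray \<G> G \<mu> = {dual_scale \<G> G r \<mu> |r. r > 0}"

definition ray_preimage ::
  "'g monoid \<Rightarrow> ('g, 'h::real_normed_vector) mfd \<Rightarrow> ('a, 'e::real_normed_vector) mfd \<Rightarrow>
     ('g \<Rightarrow> 'a \<Rightarrow> 'a) \<Rightarrow> ('a \<Rightarrow> ('a, 'e) tvec \<Rightarrow> real) \<Rightarrow> (('g, 'h) tvec \<Rightarrow> real) \<Rightarrow> 'a set" where
  "ray_preimage \<G> G M \<Phi> \<theta> \<mu> = {p \<in> points M. momentum_map \<G> G M \<Phi> \<theta> p \<in> ray \<G> G \<mu>}"

end

theory Submission
  imports Defs
begin

text \<open>
  Fix \<open>\<xi>\<close> in the Lie algebra and write \<open>J\<^sub>\<xi> = \<theta>(\<xi>\<^sub>M)\<close>. Invariance of \<open>\<theta>\<close> gives \<open>L\<^bsub>\<xi>\<^sub>M\<^esub> \<theta> = 0\<close>, hence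
  by Cartan's formula \<open>dJ\<^sub>\<xi> = - i\<^bsub>\<xi>\<^sub>M\<^esub> d\<theta>\<close>. Evaluated on \<open>X\<close>, with \<open>\<omega> = - d\<theta>\<close> and
  \<open>i\<^sub>X \<omega> = dH - f \<theta>\<close>, this is
  \<open>X(J\<^sub>\<xi>) = d\<theta>(X, \<xi>\<^sub>M) = - \<omega>(X, \<xi>\<^sub>M) = f \<theta>(\<xi>\<^sub>M) - dH(\<xi>\<^sub>M) = f J\<^sub>\<xi>\<close>,
  where \<open>dH(\<xi>\<^sub>M) = 0\<close> because \<open>H\<close> is constant on orbits. So along an integral curve \<open>x\<close> every
  component of the momentum solves the same scalar equation \<open>j' = f(x(t)) j\<close>, and all of them are
  multiplied by the positive factor \<open>exp (\<integral>f(x(s)) ds)\<close>; in particular rays are preserved. With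
  these conventions for \<open>\<omega>\<close> and \<open>X\<close> the exponent carries a plus sign.
  Invariance of \<open>X\<close> is separate: pushing \<open>X\<close> forward by a group element preserves \<open>d\<theta>\<close>, \<open>dH\<close>
  and \<open>f \<theta>\<close>, so it yields another solution of the equation that determines \<open>X\<close>.

  In charts, both \<open>dJ\<^sub>\<xi> = - i\<^bsub>\<xi>\<^sub>M\<^esub> d\<theta>\<close> (\<open>momentum_map_derivative\<close>) and the
  compatibility of \<open>d\<close> with pullbacks (\<open>exterior_derivative_pullback\<close>) result from differentiating an
  identity of the form \<open>\<eta>(\<psi>(y))(D\<psi>(y) w) = \<theta>(y)(w)\<close>. This takes two facts of calculus: second
  derivatives are symmetric (\<open>smooth_on_mixed_derivatives_commute\<close>), and a family of linear
  functionals that is differentiable on each fixed vector obeys the product rule when the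
  vector varies as well (\<open>has_derivative_linear_family\<close>). The model spaces are normed spaces that are
  only assumed to have a finite spanning set, so the latter rests on the boundedness of coordinates
  (\<open>coordinates_bounded\<close>).
\<close>

section \<open>Calculus in normed spaces\<close>

lemma norm_increment_le:
  fixes k :: "real \<Rightarrow> 'b::real_normed_vector"
  assumes "0 \<le> t"
    and k: "\<And>\<tau>. \<tau> \<in> {0..t} \<Longrightarrow> (k has_vector_derivative k' \<tau>) (at \<tau>)"
    and bound: "\<And>\<tau>. \<tau> \<in> {0..t} \<Longrightarrow> norm (k' \<tau>) \<le> B"
  shows "norm (k t - k 0) \<le> B * t"
proof -
  have "norm (k t - k 0) \<le> B * norm (t - 0)"
  proof (rule differentiable_bound)
    show "convex {0..t}" by simp
    show "(k has_derivative (\<lambda>r. r *\<^sub>R k' \<tau>)) (at \<tau> within {0..t})" if "\<tau> \<in> {0..t}" for \<tau>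
      using k[OF that] by (simp add: has_vector_derivative_def has_derivative_at_withinI)
    show "onorm (\<lambda>r. r *\<^sub>R k' \<tau>) \<le> B" if "\<tau> \<in> {0..t}" for \<tau>
      proof (rule onorm_le)
      show "norm (r *\<^sub>R k' \<tau>) \<le> B * norm r" for r
        using mult_right_mono[OF bound[OF that], of "\<bar>r\<bar>"] by (simp add: mult.commute)
    qed
  qed (use assms in auto)
  then show ?thesis using assms by simp
qed

lemma has_vector_derivative_along_line:
  fixes f :: "'a::real_normed_vector \<Rightarrow> 'b::real_normed_vector"
  assumes "f differentiable (at (z + \<sigma> *\<^sub>R u))"
  shows "((\<lambda>\<sigma>. f (z + \<sigma> *\<^sub>R u)) has_vector_derivative
           frechet_derivative f (at (z + \<sigma> *\<^sub>R u)) u) (at \<sigma>)"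
proof -
  let ?D = "frechet_derivative f (at (z + \<sigma> *\<^sub>R u))"
  have f: "(f has_derivative ?D) (at (z + \<sigma> *\<^sub>R u))"
    using assms by (simp add: frechet_derivative_works)
  have "((\<lambda>\<sigma>. z + \<sigma> *\<^sub>R u) has_derivative (\<lambda>r. r *\<^sub>R u)) (at \<sigma>)"
    by (auto intro!: derivative_eq_intros)
  from has_derivative_compose[OF this f]
  show ?thesis
    using linear_cmul[OF has_derivative_linear[OF f]]
    by (simp add: has_vector_derivative_def)
qed

text \<open>
  Two applications of the mean value inequality: along \<open>v\<close> to \<open>D\<^sub>u f\<close>, which compares the increment
  of \<open>D\<^sub>u f\<close> with \<open>D\<^sub>v D\<^sub>u f(x)\<close>, and then along \<open>u\<close> to the increment of \<open>f\<close> in direction \<open>v\<close>.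
  Linear terms are subtracted first, so that only the deviation of \<open>D\<^sub>v D\<^sub>u f\<close> from its value
  at \<open>x\<close> remains to be estimated.
\<close>

lemma second_difference_estimate:
  fixes f :: "'a::real_normed_vector \<Rightarrow> 'b::real_normed_vector"
  assumes S: "open S" "x \<in> S"
    and f: "\<And>y. y \<in> S \<Longrightarrow> f differentiable (at y)"
    and Du: "\<And>y. y \<in> S \<Longrightarrow> (\<lambda>y. frechet_derivative f (at y) u) differentiable (at y)"
    and cont: "continuous_on S
      (\<lambda>y. frechet_derivative (\<lambda>y. frechet_derivative f (at y) u) (at y) v)"
    and "\<epsilon> > 0"
  shows "\<exists>\<delta>>0. \<forall>s t. 0 < s \<longrightarrow> s < \<delta> \<longrightarrow> 0 < t \<longrightarrow> t < \<delta> \<longrightarrow>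
    norm (f (x + s *\<^sub>R u + t *\<^sub>R v) - f (x + s *\<^sub>R u) - (f (x + t *\<^sub>R v) - f x)
      - (s * t) *\<^sub>R frechet_derivative (\<lambda>y. frechet_derivative f (at y) u) (at x) v) \<le> \<epsilon> * t * s"
proof -
  let ?Du = "\<lambda>y. frechet_derivative f (at y) u"
  let ?g = "\<lambda>y. frechet_derivative ?Du (at y) v"
  let ?A = "?g x"
  from cont S have "continuous (at x) ?g"
    by (simp add: continuous_on_eq_continuous_at)
  then obtain d1 where d1: "d1 > 0" "\<And>z. dist z x < d1 \<Longrightarrow> dist (?g z) ?A < \<epsilon>"
    using \<open>\<epsilon> > 0\<close> by (auto simp: continuous_at_eps_delta)
  obtain d2 where d2: "d2 > 0" "ball x d2 \<subseteq> S"
    using S openE by blast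
  define d where "d = min d1 d2"
  define \<delta> where "\<delta> = d / (norm u + norm v + 1)"
  have "norm u + norm v + 1 > 0"
    by (smt (verit) norm_ge_zero)
  then have \<delta>: "\<delta> > 0" "\<delta> * (norm u + norm v + 1) = d"
    using d1 d2 by (auto simp: \<delta>_def d_def)
  have near: "dist (x + \<sigma> *\<^sub>R u + \<tau> *\<^sub>R v) x < d"
    if "0 \<le> \<sigma>" "\<sigma> < \<delta>" "0 \<le> \<tau>" "\<tau> < \<delta>" for \<sigma> \<tau>
  proof -
    have "dist (x + \<sigma> *\<^sub>R u + \<tau> *\<^sub>R v) x \<le> \<sigma> * norm u + \<tau> * norm v"
      using that norm_triangle_ineq[of "\<sigma> *\<^sub>R u" "\<tau> *\<^sub>R v"] by (simp add: dist_norm add.assoc)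
    also have "\<dots> \<le> \<delta> * norm u + \<delta> * norm v"
      using that by (intro add_mono mult_right_mono) auto
    also have "\<dots> < \<delta> * (norm u + norm v + 1)"
      using \<delta> by (simp add: algebra_simps)
    finally show ?thesis using \<delta> by simp
  qed
  have inS: "x + \<sigma> *\<^sub>R u + \<tau> *\<^sub>R v \<in> S"
    if "0 \<le> \<sigma>" "\<sigma> < \<delta>" "0 \<le> \<tau>" "\<tau> < \<delta>" for \<sigma> \<tau>
    using near[OF that] d2 by (auto simp: d_def dist_commute subset_eq)
  have g: "norm (?g (x + \<sigma> *\<^sub>R u + \<tau> *\<^sub>R v) - ?A) \<le> \<epsilon>"
    if "0 \<le> \<sigma>" "\<sigma> < \<delta>" "0 \<le> \<tau>" "\<tau> < \<delta>" for \<sigma> \<tau>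
    using near[OF that] d1(2)[of "x + \<sigma> *\<^sub>R u + \<tau> *\<^sub>R v"] by (simp add: d_def dist_norm)
  have est: "norm (f (x + s *\<^sub>R u + t *\<^sub>R v) - f (x + s *\<^sub>R u) - (f (x + t *\<^sub>R v) - f x)
      - (s * t) *\<^sub>R ?A) \<le> \<epsilon> * t * s"
    if st: "0 < s" "s < \<delta>" "0 < t" "t < \<delta>" for s t
  proof -
    have inner: "norm (?Du (x + \<sigma> *\<^sub>R u + t *\<^sub>R v) - ?Du (x + \<sigma> *\<^sub>R u) - t *\<^sub>R ?A) \<le> \<epsilon> * t"
      if \<sigma>: "\<sigma> \<in> {0..s}" for \<sigma>
    proof -
      let ?k = "\<lambda>\<tau>. ?Du (x + \<sigma> *\<^sub>R u + \<tau> *\<^sub>R v) - \<tau> *\<^sub>R ?A"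
      have "norm (?k t - ?k 0) \<le> \<epsilon> * t"
      proof (rule norm_increment_le)
        fix \<tau> assume \<tau>: "\<tau> \<in> {0..t}"
        show "(?k has_vector_derivative ?g (x + \<sigma> *\<^sub>R u + \<tau> *\<^sub>R v) - ?A) (at \<tau>)"
          using \<sigma> \<tau> st
          by (auto intro!: derivative_eq_intros has_vector_derivative_along_line Du inS)
        show "norm (?g (x + \<sigma> *\<^sub>R u + \<tau> *\<^sub>R v) - ?A) \<le> \<epsilon>"
          using \<sigma> \<tau> st by (intro g) auto
      qed (use st in auto)
      then show ?thesis by (simp add: algebra_simps)
    qed
    let ?h = "\<lambda>\<sigma>. f (x + t *\<^sub>R v + \<sigma> *\<^sub>R u) - f (x + \<sigma> *\<^sub>R u) - \<sigma> *\<^sub>R (t *\<^sub>R ?A)"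
    have "norm (?h s - ?h 0) \<le> (\<epsilon> * t) * s"
    proof (rule norm_increment_le)
      fix \<sigma> assume \<sigma>: "\<sigma> \<in> {0..s}"
      have "x + t *\<^sub>R v + \<sigma> *\<^sub>R u \<in> S"
        using inS[of \<sigma> t] \<sigma> st by (simp add: add.commute add.left_commute)
      moreover have "x + \<sigma> *\<^sub>R u \<in> S"
        using inS[of \<sigma> 0] \<sigma> st by simp
      ultimately show "(?h has_vector_derivative
          ?Du (x + t *\<^sub>R v + \<sigma> *\<^sub>R u) - ?Du (x + \<sigma> *\<^sub>R u) - t *\<^sub>R ?A) (at \<sigma>)"
        by (auto intro!: derivative_eq_intros has_vector_derivative_along_line f)
      show "norm (?Du (x + t *\<^sub>R v + \<sigma> *\<^sub>R u) - ?Du (x + \<sigma> *\<^sub>R u) - t *\<^sub>R ?A) \<le> \<epsilon> * t"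
        using inner[OF \<sigma>] by (simp add: add.commute add.left_commute)
    qed (use st in auto)
    then show ?thesis by (simp add: algebra_simps)
  qed
  show ?thesis
    using \<delta>(1) est by (intro exI[of _ \<delta>]) blast
qed

lemma smooth_on_imp_differentiable: "smooth_on S f \<Longrightarrow> x \<in> S \<Longrightarrow> f differentiable (at x)"
  unfolding smooth_on_def by (metis Ck_on.simps(2))

lemma smooth_on_imp_continuous_on: "smooth_on S f \<Longrightarrow> continuous_on S f"
  unfolding smooth_on_def by (metis Ck_on.simps(1))

lemma smooth_on_frechet_derivative:
  "smooth_on S f \<Longrightarrow> smooth_on S (\<lambda>x. frechet_derivative f (at x) v)"
  unfolding smooth_on_def by (metis Ck_on.simps(2))

lemma smooth_on_has_derivative:
  "smooth_on S f \<Longrightarrow> x \<in> S \<Longrightarrow> (f has_derivative frechet_derivative f (at x)) (at x)"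
  using smooth_on_imp_differentiable frechet_derivative_works by blast

text \<open>
  Both mixed derivatives govern the same second difference, which is symmetric in the two
  directions.
\<close>

lemma smooth_on_mixed_derivatives_commute:
  fixes f :: "'a::real_normed_vector \<Rightarrow> 'b::real_normed_vector"
  assumes f: "smooth_on S f" and S: "open S" "x \<in> S"
  shows "frechet_derivative (\<lambda>y. frechet_derivative f (at y) u) (at x) v =
         frechet_derivative (\<lambda>y. frechet_derivative f (at y) v) (at x) u" (is "?A = ?B")
proof (rule ccontr)
  assume "?A \<noteq> ?B"
  define \<epsilon> where "\<epsilon> = norm (?A - ?B) / 3"
  have \<epsilon>: "\<epsilon> > 0" using \<open>?A \<noteq> ?B\<close> by (simp add: \<epsilon>_def)
  note D = smooth_on_imp_differentiable[OF f]
    smooth_on_imp_differentiable[OF smooth_on_frechet_derivative[OF f]]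
    smooth_on_imp_continuous_on[OF smooth_on_frechet_derivative[OF smooth_on_frechet_derivative[OF f]]]
  obtain d1 where d1: "d1 > 0" "\<And>s t. \<lbrakk>0 < s; s < d1; 0 < t; t < d1\<rbrakk> \<Longrightarrow>
    norm (f (x + s *\<^sub>R u + t *\<^sub>R v) - f (x + s *\<^sub>R u) - (f (x + t *\<^sub>R v) - f x) - (s * t) *\<^sub>R ?A) \<le> \<epsilon> * t * s"
    using second_difference_estimate[OF S D(1) D(2) D(3) \<epsilon>, of u v] by metis
  obtain d2 where d2: "d2 > 0" "\<And>s t. \<lbrakk>0 < s; s < d2; 0 < t; t < d2\<rbrakk> \<Longrightarrow>
    norm (f (x + s *\<^sub>R v + t *\<^sub>R u) - f (x + s *\<^sub>R v) - (f (x + t *\<^sub>R u) - f x) - (s * t) *\<^sub>R ?B) \<le> \<epsilon> * t * s"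
    using second_difference_estimate[OF S D(1) D(2) D(3) \<epsilon>, of v u] by metis
  define s where "s = min d1 d2 / 2"
  have s: "0 < s" "s < d1" "s < d2" using d1(1) d2(1) by (auto simp: s_def)
  let ?\<Delta> = "f (x + s *\<^sub>R u + s *\<^sub>R v) - f (x + s *\<^sub>R u) - (f (x + s *\<^sub>R v) - f x)"
  have 1: "norm (?\<Delta> - (s * s) *\<^sub>R ?A) \<le> \<epsilon> * s * s"
    using d1(2)[of s s] s by blast
  have "x + s *\<^sub>R v + s *\<^sub>R u = x + s *\<^sub>R u + s *\<^sub>R v" by simp
  then have 2: "norm (?\<Delta> - (s * s) *\<^sub>R ?B) \<le> \<epsilon> * s * s"
    using d2(2)[of s s] s by (simp add: algebra_simps)
  have "(s * s) *\<^sub>R (?A - ?B) = (?\<Delta> - (s * s) *\<^sub>R ?B) - (?\<Delta> - (s * s) *\<^sub>R ?A)"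
    by (simp add: algebra_simps)
  then have "norm ((s * s) *\<^sub>R (?A - ?B)) \<le>
      norm (?\<Delta> - (s * s) *\<^sub>R ?B) + norm (?\<Delta> - (s * s) *\<^sub>R ?A)"
    by (metis norm_triangle_ineq4)
  also have "\<dots> \<le> \<epsilon> * s * s + \<epsilon> * s * s"
    by (rule add_mono[OF 2 1])
  also have "\<dots> = 2 * \<epsilon> * (s * s)" by simp
  finally have "norm ((s * s) *\<^sub>R (?A - ?B)) \<le> 2 * \<epsilon> * (s * s)" .
  then have "(s * s) * norm (?A - ?B) \<le> (s * s) * (2 * \<epsilon>)"
    using s by (simp add: mult.commute)
  then have "norm (?A - ?B) \<le> 2 * \<epsilon>"
    using s by (simp add: mult_le_cancel_left_pos)
  then show False using \<epsilon> by (simp add: \<epsilon>_def)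
qed

lemma Ck_on_cong:
  assumes "open S" "\<And>x. x \<in> S \<Longrightarrow> f x = g x"
  shows "Ck_on k S f \<Longrightarrow> Ck_on k S g"
  using assms(2)
proof (induction k arbitrary: f g)
  case 0
  then show ?case using continuous_on_cong[of S S f g] by simp
next
  case (Suc k)
  have D: "f differentiable (at x)" "g differentiable (at x)"
      "frechet_derivative f (at x) = frechet_derivative g (at x)" if "x \<in> S" for x
  proof -
    show f: "f differentiable (at x)" using Suc.prems that by simp
    then show "frechet_derivative f (at x) = frechet_derivative g (at x)"
      using frechet_derivative_transform_within_open[OF f \<open>open S\<close> that] Suc.prems(2) by blast
    show "g differentiable (at x)"
      using f has_derivative_transform_within_open[OF _ \<open>open S\<close> that] Suc.prems(2)
      unfolding differentiable_def by metis
  qed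
  have "Ck_on k S (\<lambda>x. frechet_derivative g (at x) v)" for v
    by (rule Suc.IH[of "\<lambda>x. frechet_derivative f (at x) v"]) (use Suc.prems D in auto)
  with D show ?case by simp
qed

text \<open>
  Affine maps are what fixing one argument of a map on a product amounts to. Their derivative is
  constant, so that the directional derivatives of \<open>f (a + L x)\<close> are again of this form, which
  closes the induction on \<open>k\<close>.
\<close>

lemma Ck_on_compose_affine:
  assumes S: "open S" and L: "bounded_linear L"
  shows "Ck_on k S f \<Longrightarrow> Ck_on k ((\<lambda>x. a + L x) -` S) (\<lambda>x. f (a + L x))"
proof (induction k arbitrary: f)
  case 0
  have "continuous_on ((\<lambda>x. a + L x) -` S) (\<lambda>x. a + L x)"
    by (intro continuous_intros linear_continuous_on L)
  then show ?case using 0 continuous_on_compose2[of S f _ "\<lambda>x. a + L x"] by auto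
next
  case (Suc k)
  let ?T = "(\<lambda>x. a + L x) -` S"
  have T: "open ?T"
    by (intro open_vimage S continuous_intros linear_continuous_on L)
  have D: "((\<lambda>x. f (a + L x)) has_derivative (\<lambda>v. frechet_derivative f (at (a + L x)) (L v))) (at x)"
    if "x \<in> ?T" for x
  proof -
    have "(f has_derivative frechet_derivative f (at (a + L x))) (at (a + L x))"
      using Suc.prems that by (simp add: frechet_derivative_works)
    moreover have "((\<lambda>x. a + L x) has_derivative L) (at x)"
      using bounded_linear_imp_has_derivative[OF L] by (auto intro!: derivative_eq_intros)
    ultimately show ?thesis by (rule has_derivative_compose[rotated])
  qed
  have "Ck_on k ?T (\<lambda>x. frechet_derivative (\<lambda>x. f (a + L x)) (at x) v)" for v
  proof (rule Ck_on_cong[OF T])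
    show "Ck_on k ?T (\<lambda>x. frechet_derivative f (at (a + L x)) (L v))"
      using Suc.IH[of "\<lambda>y. frechet_derivative f (at y) (L v)"] Suc.prems by simp
    show "frechet_derivative f (at (a + L x)) (L v) = frechet_derivative (\<lambda>x. f (a + L x)) (at x) v"
      if "x \<in> ?T" for x
      using frechet_derivative_at[OF D[OF that]] by metis
  qed
  moreover have "(\<lambda>x. f (a + L x)) differentiable (at x)" if "x \<in> ?T" for x
    using D[OF that] by (auto simp: differentiable_def)
  ultimately show ?case by simp
qed

lemma smooth_on_cong:
  "smooth_on S f \<Longrightarrow> open S \<Longrightarrow> (\<And>x. x \<in> S \<Longrightarrow> f x = g x) \<Longrightarrow> smooth_on S g"
  unfolding smooth_on_def using Ck_on_cong by blast

lemma smooth_on_compose_affine: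
  "smooth_on S f \<Longrightarrow> open S \<Longrightarrow> bounded_linear L \<Longrightarrow>
     smooth_on ((\<lambda>x. a + L x) -` S) (\<lambda>x. f (a + L x))"
  unfolding smooth_on_def using Ck_on_compose_affine by blast


section \<open>Linear functionals depending smoothly on a point\<close>

text \<open>
  Induction on the basis. The coordinate along a new vector \<open>b\<close> is bounded by the inverse of the
  distance from \<open>b\<close> to \<open>span B\<close>. This distance is positive: in a sequence of combinations of \<open>B\<close>
  that tends to \<open>b\<close> the coefficients would converge by the induction hypothesis, and their limits
  would express \<open>b\<close> in terms of \<open>B\<close>.
\<close>

lemma coordinates_bounded:
  fixes B :: "'e::real_normed_vector set"
  assumes "finite B" "independent B"
  shows "\<exists>K\<ge>0. \<forall>a. \<forall>b\<in>B. \<bar>a b\<bar> \<le> K * norm (\<Sum>b\<in>B. a b *\<^sub>R b)"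
  using assms
proof (induction B)
  case empty
  then show ?case by auto
next
  case (insert b B)
  have ind: "independent B" and bnot: "b \<notin> span B"
    using insert by (auto simp: independent_insert)
  obtain K where K: "K \<ge> 0" "\<And>a b'. b' \<in> B \<Longrightarrow> \<bar>a b'\<bar> \<le> K * norm (\<Sum>b\<in>B. a b *\<^sub>R b)"
    using insert.IH[OF ind] by blast
  have "\<exists>d>0. \<forall>a. d \<le> norm (b - (\<Sum>b\<in>B. a b *\<^sub>R b))"
  proof (rule ccontr)
    assume "\<not> ?thesis"
    then have "\<forall>n::nat. \<exists>a. norm (b - (\<Sum>b\<in>B. a b *\<^sub>R b)) < 1 / Suc n"
      by (metis not_le zero_less_divide_1_iff of_nat_0_less_iff zero_less_Suc)
    then obtain a where a: "\<And>n::nat. norm (b - (\<Sum>b\<in>B. a n b *\<^sub>R b)) < 1 / Suc n"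
      by metis
    let ?y = "\<lambda>n. \<Sum>b\<in>B. a n b *\<^sub>R b"
    have "(\<lambda>n. norm (?y n - b)) \<longlonglongrightarrow> 0"
      by (rule tendsto_sandwich[OF _ _ tendsto_const LIMSEQ_inverse_real_of_nat])
        (use a in \<open>auto intro!: always_eventually less_imp_le simp: norm_minus_commute inverse_eq_divide\<close>)
    then have lim: "?y \<longlonglongrightarrow> b"
      using tendsto_norm_zero_iff LIM_zero_cancel by blast
    have "convergent (\<lambda>n. a n b')" if b': "b' \<in> B" for b'
    proof -
      have C: "Cauchy ?y" using lim LIMSEQ_imp_Cauchy by blast
      have "Cauchy (\<lambda>n. a n b')"
      proof (rule metric_CauchyI)
        fix e :: real assume "e > 0"
        then have "e / (K + 1) > 0" using K by simp
        then obtain N where N: "\<And>m n. m \<ge> N \<Longrightarrow> n \<ge> N \<Longrightarrow> dist (?y m) (?y n) < e / (K + 1)"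
          using metric_CauchyD[OF C] by blast
        have "dist (a m b') (a n b') < e" if "m \<ge> N" "n \<ge> N" for m n
        proof -
          have "dist (a m b') (a n b') \<le> K * norm (?y m - ?y n)"
            using K(2)[OF b', of "\<lambda>b. a m b - a n b"]
            by (simp add: dist_real_def scaleR_diff_left sum_subtractf)
          also have "\<dots> \<le> (K + 1) * norm (?y m - ?y n)"
            using K by (intro mult_right_mono) auto
          also have "\<dots> < e"
            using N[OF that] K by (simp add: dist_norm field_simps)
          finally show ?thesis .
        qed
        then show "\<exists>N. \<forall>m\<ge>N. \<forall>n\<ge>N. dist (a m b') (a n b') < e" by blast
      qed
      then show ?thesis by (rule Cauchy_convergent)
    qed
    then have "(\<lambda>n. a n b') \<longlonglongrightarrow> lim (\<lambda>n. a n b')" if "b' \<in> B" for b'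
      using that convergent_LIMSEQ_iff by blast
    then have "?y \<longlonglongrightarrow> (\<Sum>b\<in>B. lim (\<lambda>n. a n b) *\<^sub>R b)"
      by (intro tendsto_sum tendsto_scaleR tendsto_const)
    then have "b = (\<Sum>b\<in>B. lim (\<lambda>n. a n b) *\<^sub>R b)"
      using lim LIMSEQ_unique by blast
    also have "\<dots> \<in> span B"
      by (intro span_sum span_scale span_base)
    finally show False using bnot by blast
  qed
  then obtain d where d: "d > 0" "\<And>a. d \<le> norm (b - (\<Sum>b\<in>B. a b *\<^sub>R b))"
    by blast
  define L where "L = 1 / d + K * (1 + norm b / d)"
  have "\<bar>a b'\<bar> \<le> L * norm (\<Sum>b\<in>insert b B. a b *\<^sub>R b)" if b': "b' \<in> insert b B" for a b'
  proof -
    let ?y = "\<Sum>b\<in>B. a b *\<^sub>R b"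
    let ?x = "\<Sum>b\<in>insert b B. a b *\<^sub>R b"
    have x: "?x = a b *\<^sub>R b + ?y" using insert by simp
    have ab: "\<bar>a b\<bar> \<le> norm ?x / d"
    proof (cases "a b = 0")
      case False
      have "?x = a b *\<^sub>R (b - (\<Sum>b'\<in>B. (- a b' / a b) *\<^sub>R b'))"
        using False by (simp add: x scaleR_add_right scaleR_diff_right scaleR_sum_right sum_negf)
      then have "norm ?x = \<bar>a b\<bar> * norm (b - (\<Sum>b'\<in>B. (- a b' / a b) *\<^sub>R b'))"
        by simp
      also have "\<dots> \<ge> \<bar>a b\<bar> * d"
        using d(2)[of "\<lambda>b'. - a b' / a b"] by (intro mult_left_mono) auto
      finally show ?thesis using d by (simp add: field_simps)
    qed (use d in simp)
    have "norm ?y \<le> norm ?x + \<bar>a b\<bar> * norm b"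
      using norm_triangle_ineq4[of ?x "a b *\<^sub>R b"] by (simp add: x)
    also have "\<dots> \<le> norm ?x + norm ?x / d * norm b"
      using ab by (intro add_left_mono mult_right_mono) auto
    finally have y: "K * norm ?y \<le> K * (1 + norm b / d) * norm ?x"
      using mult_left_mono[OF _ K(1)] by (fastforce simp: algebra_simps)
    show ?thesis
    proof (cases "b' = b")
      case True
      have "0 \<le> K * (1 + norm b / d) * norm ?x" using K d by simp
      with ab True show ?thesis by (simp add: L_def algebra_simps)
    next
      case False
      then have "\<bar>a b'\<bar> \<le> K * norm ?y" using b' K(2) by blast
      moreover have "0 \<le> norm ?x / d" using d by simp
      ultimately show ?thesis using y by (simp add: L_def algebra_simps)
    qed
  qed
  moreover have "L \<ge> 0" using K d by (simp add: L_def)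
  ultimately show ?case by blast
qed

lemma bounded_linear_coordinates:
  fixes B :: "'e::real_normed_vector set"
  assumes "finite B" "independent B" "span B = UNIV"
  shows "bounded_linear (\<lambda>x. representation B x b)"
proof -
  obtain K where K: "\<And>a b'. b' \<in> B \<Longrightarrow> \<bar>a b'\<bar> \<le> K * norm (\<Sum>b\<in>B. a b *\<^sub>R b)"
    using coordinates_bounded[OF assms(1,2)] by blast
  show ?thesis
  proof (cases "b \<in> B")
    case True
    show ?thesis
    proof (rule bounded_linear_intro[of _ K])
      show "norm (representation B x b) \<le> norm x * K" for x
        using K[OF True, of "representation B x"]
          real_vector.sum_representation_eq[of B x B] assms by (simp add: mult.commute)
    qed (use assms in \<open>simp_all add: real_vector.representation_add real_vector.representation_scale\<close>)
  next
    case False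
    then have "representation B x b = 0" for x
      using real_vector.representation_ne_zero[of B x b] by blast
    then show ?thesis by simp
  qed
qed

text \<open>
  The product rule for the evaluation pairing of a family of linear functionals \<open>\<Theta> \<cdot> y\<close>
  with a vector. Expansion in a basis makes it a finite sum of products, so that differentiability
  of the family on each fixed vector suffices.
\<close>

lemma has_derivative_linear_family:
  fixes \<Theta> :: "'e::real_normed_vector \<Rightarrow> 'a::real_normed_vector \<Rightarrow> real"
    and a :: "'z::real_normed_vector \<Rightarrow> 'a"
  assumes fin: "\<exists>B::'e set. finite B \<and> span B = UNIV"
    and U: "open U" "a z \<in> U"
    and lin: "\<And>y. y \<in> U \<Longrightarrow> linear (\<lambda>w. \<Theta> w y)"
    and diff: "\<And>w. \<Theta> w differentiable (at (a z))"
    and a: "(a has_derivative a') (at z)"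
    and b: "(b has_derivative b') (at z)"
  shows "((\<lambda>x. \<Theta> (b x) (a x)) has_derivative
     (\<lambda>v. frechet_derivative (\<Theta> (b z)) (at (a z)) (a' v) + \<Theta> (b' v) (a z))) (at z)"
proof -
  obtain B0 :: "'e set" where "finite B0" "span B0 = UNIV" using fin by blast
  then obtain B :: "'e set" where B: "finite B" "independent B" "span B = UNIV"
    by (metis finite_subset maximal_independent_subset span_mono span_span top.extremum_uniqueI)
  let ?\<beta> = "\<lambda>k w. representation B w k"
  have expand: "\<Theta> w y = (\<Sum>k\<in>B. ?\<beta> k w * \<Theta> k y)" if "y \<in> U" for w y
  proof -
    interpret linear "\<lambda>w. \<Theta> w y" using lin[OF that] .
    have "w = (\<Sum>k\<in>B. ?\<beta> k w *\<^sub>R k)"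
      using real_vector.sum_representation_eq[of B w B] B by simp
    then have "\<Theta> w y = \<Theta> (\<Sum>k\<in>B. ?\<beta> k w *\<^sub>R k) y" by simp
    also have "\<dots> = (\<Sum>k\<in>B. ?\<beta> k w * \<Theta> k y)" by (simp add: sum scale)
    finally show ?thesis .
  qed
  let ?D = "\<lambda>w. frechet_derivative (\<Theta> w) (at (a z))"
  have D: "(\<Theta> w has_derivative ?D w) (at (a z))" for w
    using diff by (simp add: frechet_derivative_works)
  have Dsum: "?D w v = (\<Sum>k\<in>B. ?\<beta> k w * ?D k v)" for w v
  proof -
    have "((\<lambda>y. \<Sum>k\<in>B. ?\<beta> k w * \<Theta> k y) has_derivative (\<lambda>v. \<Sum>k\<in>B. ?\<beta> k w * ?D k v)) (at (a z))"
      by (auto intro!: derivative_eq_intros D)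
    then have "(\<Theta> w has_derivative (\<lambda>v. \<Sum>k\<in>B. ?\<beta> k w * ?D k v)) (at (a z))"
      by (rule has_derivative_transform_within_open[OF _ U]) (metis expand)
    then show ?thesis using frechet_derivative_at by metis
  qed
  have \<beta>: "((\<lambda>x. ?\<beta> k (b x)) has_derivative (\<lambda>v. ?\<beta> k (b' v))) (at z)" for k
    by (rule bounded_linear.has_derivative[OF bounded_linear_coordinates[OF B] b])
  have \<Theta>: "((\<lambda>x. \<Theta> w (a x)) has_derivative (\<lambda>v. ?D w (a' v))) (at z)" for w
    by (rule has_derivative_compose[OF a D])
  have "((\<lambda>x. \<Sum>k\<in>B. ?\<beta> k (b x) * \<Theta> k (a x)) has_derivative
      (\<lambda>v. \<Sum>k\<in>B. ?\<beta> k (b z) * ?D k (a' v) + ?\<beta> k (b' v) * \<Theta> k (a z))) (at z)"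
    by (intro has_derivative_sum has_derivative_mult \<beta> \<Theta>)
  moreover have "(\<Sum>k\<in>B. ?\<beta> k (b z) * ?D k (a' v) + ?\<beta> k (b' v) * \<Theta> k (a z)) =
      ?D (b z) (a' v) + \<Theta> (b' v) (a z)" for v
    using Dsum[of "b z" "a' v"] expand[OF U(2), of "b' v"] by (simp add: sum.distrib)
  ultimately have sum: "((\<lambda>x. \<Sum>k\<in>B. ?\<beta> k (b x) * \<Theta> k (a x)) has_derivative
      (\<lambda>v. ?D (b z) (a' v) + \<Theta> (b' v) (a z))) (at z)" by simp
  have "continuous (at z) a" using a has_derivative_continuous by blast
  then have "\<forall>\<^sub>F x in at z. a x \<in> U"
    using U by (simp add: continuous_at tendsto_def)
  then have "\<forall>\<^sub>F x in at z. (\<Sum>k\<in>B. ?\<beta> k (b x) * \<Theta> k (a x)) = \<Theta> (b x) (a x)"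
    by eventually_elim (metis expand)
  from has_derivative_transform_eventually[OF sum this] show ?thesis
    using expand[OF U(2), of "b z"] by simp
qed


section \<open>Charts and derivatives in charts\<close>

abbreviation chart_deriv ::
  "('a, 'e::real_normed_vector) chart \<Rightarrow> ('a \<Rightarrow> 'b::real_normed_vector) \<Rightarrow> 'a \<Rightarrow> 'e \<Rightarrow> 'b" where
  "chart_deriv c q p \<equiv> frechet_derivative (q \<circ> chart_inv c) (at (snd c p))"

lemma charts_atD: "c \<in> charts_at M p \<Longrightarrow> c \<in> atlas M" "c \<in> charts_at M p \<Longrightarrow> p \<in> fst c"
  by (auto simp: charts_at_def)

context smooth_manifold
begin

lemma chart_domain_subset: "c \<in> atlas M \<Longrightarrow> fst c \<subseteq> points M"
  using charts_cover by auto

lemma chart_inj: "c \<in> atlas M \<Longrightarrow> inj_on (snd c) (fst c)"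
  using homeomorphic_imp_injective_map[OF chart_homeomorphism] chart_domain_subset
  by (metis topspace_subtopology_subset)

lemma chart_inv_chart: "c \<in> atlas M \<Longrightarrow> p \<in> fst c \<Longrightarrow> chart_inv c (snd c p) = p"
  using chart_inj by simp

lemma some_chart_at: "p \<in> points M \<Longrightarrow> some_chart M p \<in> charts_at M p"
proof -
  assume "p \<in> points M"
  then have "\<exists>c. c \<in> charts_at M p"
    unfolding charts_at_def charts_cover[symmetric] by blast
  then show ?thesis unfolding some_chart_def by (rule someI_ex)
qed

lemma chart_image_Collect:
  "c \<in> atlas M \<Longrightarrow> snd c ` {p \<in> fst c. P p} = {y \<in> snd c ` fst c. P (chart_inv c y)}"
  using chart_inv_chart by auto

lemma open_chart_image_Int:
  assumes "c \<in> atlas M" "openin (topol M) V"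
  shows "open (snd c ` (fst c \<inter> V))"
proof -
  have "openin (subtopology (topol M) (fst c)) (fst c \<inter> V)"
    using assms(2) openin_subtopology_Int2 by blast
  then have "openin (top_of_set (snd c ` fst c)) (snd c ` (fst c \<inter> V))"
    using homeomorphic_imp_open_map[OF chart_homeomorphism[OF assms(1)]]
    unfolding open_map_def by blast
  then show ?thesis
    using chart_image_open[OF assms(1)] openin_open_eq by blast
qed

lemma continuous_map_chart_inv:
  assumes "c \<in> atlas M"
  shows "continuous_map (top_of_set (snd c ` fst c)) (topol M) (chart_inv c)"
proof -
  let ?X = "subtopology (topol M) (fst c)"
  have X: "topspace ?X = fst c"
    using chart_domain_subset[OF assms] by auto
  obtain g where g: "homeomorphic_maps ?X (top_of_set (snd c ` fst c)) (snd c) g"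
    using chart_homeomorphism[OF assms] homeomorphic_map_maps by blast
  then have "continuous_map (top_of_set (snd c ` fst c)) ?X g"
    by (simp add: homeomorphic_maps_def)
  moreover have "g y = chart_inv c y" if "y \<in> snd c ` fst c" for y
    using g that chart_inv_chart[OF assms] X unfolding homeomorphic_maps_def by auto
  ultimately have "continuous_map (top_of_set (snd c ` fst c)) ?X (chart_inv c)"
    by (rule continuous_map_eq) simp
  then show ?thesis by (rule continuous_map_into_fulltopology)
qed

lemma chart_change_differentiable:
  assumes "c \<in> charts_at M p" "d \<in> charts_at M p"
  shows "(snd d \<circ> chart_inv c) differentiable (at (snd c p))"
  using charts_atD[OF assms(1)] charts_atD[OF assms(2)]
  by (intro smooth_on_imp_differentiable[OF charts_compatible]) auto

text \<open>
  The chain rule in charts. Continuity of \<open>F\<close> makes the expression of \<open>q \<circ> F\<close> in \<open>c\<close> factor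
  through the chart \<open>d\<close> near \<open>p\<close>.
\<close>

lemma chart_chain_rule:
  assumes N: "smooth_manifold N" and F: "continuous_map (topol M) (topol N) F"
    and c: "c \<in> charts_at M p" and d: "d \<in> charts_at N (F p)"
    and dF: "(snd d \<circ> F \<circ> chart_inv c) differentiable (at (snd c p))"
    and dq: "(q \<circ> chart_inv d) differentiable (at (snd d (F p)))"
  shows "((q \<circ> F \<circ> chart_inv c) has_derivative
    (\<lambda>w. chart_deriv d q (F p) (chart_deriv c (snd d \<circ> F) p w))) (at (snd c p))"
proof -
  note c' = charts_atD[OF c] and d' = charts_atD[OF d]
  let ?V = "{x \<in> topspace (topol M). F x \<in> fst d}"
  let ?S = "snd c ` (fst c \<inter> ?V)"
  have "openin (topol M) ?V"
    by (rule openin_continuous_map_preimage[OF F smooth_manifold.chart_domain_open[OF N d'(1)]])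
  then have S: "open ?S" "snd c p \<in> ?S"
    using open_chart_image_Int[OF c'(1)] c'(2) d'(2) chart_domain_subset[OF c'(1)] by auto
  have "(q \<circ> chart_inv d has_derivative chart_deriv d q (F p))
      (at ((snd d \<circ> F \<circ> chart_inv c) (snd c p)))"
    using dq chart_inv_chart[OF c'] by (simp add: frechet_derivative_works)
  from diff_chain_at[OF dF[unfolded frechet_derivative_works] this]
  have "(((q \<circ> chart_inv d) \<circ> (snd d \<circ> F \<circ> chart_inv c)) has_derivative
      (\<lambda>w. chart_deriv d q (F p) (chart_deriv c (snd d \<circ> F) p w))) (at (snd c p))"
    by (simp add: comp_def)
  then show ?thesis
    by (rule has_derivative_transform_within_open[OF _ S])
      (use chart_inv_chart[OF c'(1)] smooth_manifold.chart_inv_chart[OF N d'(1)] in auto)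
qed

lemmas chart_deriv_comp = frechet_derivative_at[OF chart_chain_rule, symmetric]

lemma chart_deriv_change:
  assumes "c \<in> charts_at M p" "d \<in> charts_at M p"
    and "(q \<circ> chart_inv d) differentiable (at (snd d p))"
  shows "chart_deriv c q p w = chart_deriv d q p (chart_deriv c (snd d) p w)"
  using fun_cong[OF chart_deriv_comp[OF smooth_manifold_axioms continuous_map_id, of c p d q], of w]
    assms chart_change_differentiable[OF assms(1,2)] by simp

lemma chart_deriv_cong:
  assumes "c \<in> charts_at M p" "(q \<circ> chart_inv c) differentiable (at (snd c p))"
    and "\<And>x. x \<in> fst c \<Longrightarrow> q x = r x"
  shows "chart_deriv c q p = chart_deriv c r p"
proof (rule frechet_derivative_transform_within_open[OF assms(2)])
  show "open (snd c ` fst c)" by (rule chart_image_open[OF charts_atD(1)[OF assms(1)]])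
qed (use assms charts_atD[OF assms(1)] chart_inv_chart in auto)

lemma chart_deriv_self:
  assumes c: "c \<in> charts_at M p"
  shows "chart_deriv c (snd c) p w = w"
proof -
  have "frechet_derivative (\<lambda>y. y) (at (snd c p)) = chart_deriv c (snd c) p"
  proof (rule frechet_derivative_transform_within_open)
    show "open (snd c ` fst c)" by (rule chart_image_open[OF charts_atD(1)[OF c]])
  qed (use charts_atD[OF c] chart_inv_chart in auto)
  then show ?thesis by (metis frechet_derivative_ident)
qed

end


section \<open>Tangent vectors and tangent maps in charts\<close>

lemma tangent_space_component:
  "v \<in> tangent_space M p \<Longrightarrow> c \<in> charts_at M p \<Longrightarrow> d \<in> charts_at M p \<Longrightarrow>
     v d = chart_deriv c (snd d) p (v c)"
  unfolding tangent_space_def by blast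

lemma tangent_space_outside:
  "v \<in> tangent_space M p \<Longrightarrow> d \<notin> charts_at M p \<Longrightarrow> v d = 0"
  unfolding tangent_space_def by blast

lemma smooth_map_differentiable:
  assumes "smooth_map M N F" "c \<in> charts_at M p" "d \<in> charts_at N (F p)"
  shows "(snd d \<circ> F \<circ> chart_inv c) differentiable (at (snd c p))"
proof -
  have "smooth_on (snd c ` {p \<in> fst c. F p \<in> fst d}) (snd d \<circ> F \<circ> chart_inv c)"
    using assms(1) charts_atD[OF assms(2)] charts_atD[OF assms(3)] by (simp add: smooth_map_def)
  then show ?thesis
    by (rule smooth_on_imp_differentiable)
      (use charts_atD[OF assms(2)] charts_atD[OF assms(3)] in blast)
qed

lemma smooth_map_continuous_map: "smooth_map M N F \<Longrightarrow> continuous_map (topol M) (topol N) F"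
  by (simp add: smooth_map_def)

lemma smooth_map_in_points: "smooth_map M N F \<Longrightarrow> p \<in> points M \<Longrightarrow> F p \<in> points N"
  using continuous_map_funspace[OF smooth_map_continuous_map] by (rule funcset_mem)

context smooth_manifold
begin

lemma coord_tvec_at: "d \<in> charts_at M p \<Longrightarrow> coord_tvec M c p w d = chart_deriv c (snd d) p w"
  by (simp add: coord_tvec_def)

lemma coord_tvec_self: "c \<in> charts_at M p \<Longrightarrow> coord_tvec M c p w c = w"
  by (simp add: coord_tvec_at chart_deriv_self)

lemma coord_tvec_in_tangent_space:
  assumes "c \<in> charts_at M p"
  shows "coord_tvec M c p w \<in> tangent_space M p"
  unfolding tangent_space_def
proof (intro CollectI conjI allI impI ballI)
  show "coord_tvec M c p w d = 0" if "d \<notin> charts_at M p" for d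
    using that by (simp add: coord_tvec_def)
  show "coord_tvec M c p w d' = chart_deriv d (snd d') p (coord_tvec M c p w d)"
    if "d \<in> charts_at M p" "d' \<in> charts_at M p" for d d'
    using chart_deriv_change[OF assms that(1) chart_change_differentiable[OF that]] that
    by (simp add: coord_tvec_at)
qed

lemma coord_tvec_of_component:
  assumes "c \<in> charts_at M p" "v \<in> tangent_space M p"
  shows "coord_tvec M c p (v c) = v"
proof
  show "coord_tvec M c p (v c) d = v d" for d
    using tangent_space_component[OF assms(2,1), of d] tangent_space_outside[OF assms(2), of d]
    by (cases "d \<in> charts_at M p") (simp_all add: coord_tvec_def)
qed

lemma coord_tvec_linear:
  assumes "c \<in> charts_at M p"
  shows "coord_tvec M c p (a *\<^sub>R u + b *\<^sub>R w) =
    (\<lambda>d. a *\<^sub>R coord_tvec M c p u d + b *\<^sub>R coord_tvec M c p w d)"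
proof
  fix d
  show "coord_tvec M c p (a *\<^sub>R u + b *\<^sub>R w) d =
      a *\<^sub>R coord_tvec M c p u d + b *\<^sub>R coord_tvec M c p w d"
  proof (cases "d \<in> charts_at M p")
    case True
    then have "linear (chart_deriv c (snd d) p)"
      using chart_change_differentiable[OF assms] linear_frechet_derivative by blast
    then show ?thesis
      using True by (simp add: coord_tvec_at linear_add linear_cmul)
  qed (simp add: coord_tvec_def)
qed

text \<open>
  This frees all later computations from the chart that the definition of \<open>tangent_map\<close> selects:
  any pair of charts around \<open>p\<close> and \<open>F p\<close> may be used.
\<close>

lemma tangent_map_in_chart:
  assumes N: "smooth_manifold N" and F: "smooth_map M N F"
    and c: "c \<in> charts_at M p" and d: "d \<in> charts_at N (F p)" and v: "v \<in> tangent_space M p"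
  shows "tangent_map M N F p v = coord_tvec N d (F p) (chart_deriv c (snd d \<circ> F) p (v c))"
proof
  fix d'
  interpret N: smooth_manifold N by (rule N)
  let ?c = "some_chart M p"
  have c0: "?c \<in> charts_at M p"
    using some_chart_at chart_domain_subset[OF charts_atD(1)[OF c]] charts_atD(2)[OF c] by blast
  show "tangent_map M N F p v d' = coord_tvec N d (F p) (chart_deriv c (snd d \<circ> F) p (v c)) d'"
  proof (cases "d' \<in> charts_at N (F p)")
    case True
    note diff = smooth_map_differentiable[OF F]
    have "tangent_map M N F p v d' = chart_deriv ?c (snd d' \<circ> F) p (v ?c)"
      using True by (simp add: tangent_map_def Let_def)
    also have "v ?c = chart_deriv c (snd ?c) p (v c)"
      by (rule tangent_space_component[OF v c c0])
    also have "chart_deriv ?c (snd d' \<circ> F) p \<dots> = chart_deriv c (snd d' \<circ> F) p (v c)"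
      using chart_deriv_change[OF c c0 diff[OF c0 True]] by simp
    also have "\<dots> = chart_deriv d (snd d') (F p) (chart_deriv c (snd d \<circ> F) p (v c))"
      using chart_deriv_comp[OF N smooth_map_continuous_map[OF F] c d diff[OF c d]
          N.chart_change_differentiable[OF d True]] by simp
    finally show ?thesis
      using True by (simp add: coord_tvec_def)
  qed (simp add: tangent_map_def coord_tvec_def)
qed

lemma tangent_map_component:
  assumes "smooth_manifold N" "smooth_map M N F"
    and "c \<in> charts_at M p" "d \<in> charts_at N (F p)" "v \<in> tangent_space M p"
  shows "tangent_map M N F p v d = chart_deriv c (snd d \<circ> F) p (v c)"
  using tangent_map_in_chart[OF assms] smooth_manifold.coord_tvec_self assms by metis

lemma tangent_map_in_tangent_space:
  assumes N: "smooth_manifold N" and F: "smooth_map M N F"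
    and p: "p \<in> points M" and v: "v \<in> tangent_space M p"
  shows "tangent_map M N F p v \<in> tangent_space N (F p)"
proof -
  have "F p \<in> points N"
    by (rule smooth_map_in_points[OF F p])
  then have d: "some_chart N (F p) \<in> charts_at N (F p)"
    using smooth_manifold.some_chart_at[OF N] by blast
  show ?thesis
    unfolding tangent_map_in_chart[OF N F some_chart_at[OF p] d v]
    by (rule smooth_manifold.coord_tvec_in_tangent_space[OF N d])
qed

lemma tangent_map_left_inverse:
  assumes N: "smooth_manifold N" and F: "smooth_map M N F" and K: "smooth_map N M K"
    and KF: "\<And>x. x \<in> points M \<Longrightarrow> K (F x) = x"
    and p: "p \<in> points M" and v: "v \<in> tangent_space M p"
  shows "tangent_map N M K (F p) (tangent_map M N F p v) = v"
proof -
  interpret N: smooth_manifold N by (rule N)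
  have "F p \<in> points N"
    by (rule smooth_map_in_points[OF F p])
  then have d: "some_chart N (F p) \<in> charts_at N (F p)" (is "?d \<in> _")
    by (rule N.some_chart_at)
  have c: "some_chart M p \<in> charts_at M p" (is "?c \<in> _")
    using p by (rule some_chart_at)
  then have c': "?c \<in> charts_at M (K (F p))" by (simp add: KF p)
  have diff: "(snd ?c \<circ> K \<circ> chart_inv ?d) differentiable (at (snd ?d (F p)))"
    by (rule smooth_map_differentiable[OF K d c'])
  have chain: "((snd ?c \<circ> K \<circ> F \<circ> chart_inv ?c) has_derivative
      (\<lambda>w. chart_deriv ?d (snd ?c \<circ> K) (F p) (chart_deriv ?c (snd ?d \<circ> F) p w))) (at (snd ?c p))"
    by (rule chart_chain_rule[OF N smooth_map_continuous_map[OF F] c d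
        smooth_map_differentiable[OF F c d] diff])
  then have "(snd ?c \<circ> K \<circ> F \<circ> chart_inv ?c) differentiable (at (snd ?c p))"
    by (auto simp: differentiable_def)
  then have "chart_deriv ?c (snd ?c \<circ> K \<circ> F) p = chart_deriv ?c (snd ?c) p"
    by (rule chart_deriv_cong[OF c]) (use KF subsetD[OF chart_domain_subset[OF charts_atD(1)[OF c]]] in simp)
  then have *: "chart_deriv ?d (snd ?c \<circ> K) (F p) (chart_deriv ?c (snd ?d \<circ> F) p w) = w" for w
    using frechet_derivative_at[OF chain] chart_deriv_self[OF c] by metis
  have "tangent_map N M K (F p) (tangent_map M N F p v) =
      coord_tvec M ?c (K (F p)) (chart_deriv ?d (snd ?c \<circ> K) (F p) (tangent_map M N F p v ?d))"
    by (rule N.tangent_map_in_chart[OF smooth_manifold_axioms K d c'])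
      (rule tangent_map_in_tangent_space[OF N F p v])
  then show ?thesis
    by (simp add: tangent_map_component[OF N F c d v] * KF p coord_tvec_of_component[OF c v])
qed

lemma differential_tangent_map:
  assumes N: "smooth_manifold N" and F: "smooth_map M N F" and h: "smooth_function N h"
    and p: "p \<in> points M" and v: "v \<in> tangent_space M p"
  shows "differential N h (F p) (tangent_map M N F p v) = differential M (h \<circ> F) p v"
proof -
  have "F p \<in> points N"
    by (rule smooth_map_in_points[OF F p])
  then have d: "some_chart N (F p) \<in> charts_at N (F p)" (is "?d \<in> _")
    by (rule smooth_manifold.some_chart_at[OF N])
  have c: "some_chart M p \<in> charts_at M p" (is "?c \<in> _")
    using p by (rule some_chart_at)
  have "(h \<circ> chart_inv ?d) differentiable (at (snd ?d (F p)))"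
    using h charts_atD[OF d] unfolding smooth_function_def
    by (intro smooth_on_imp_differentiable[of "snd ?d ` fst ?d"]) auto
  from chart_deriv_comp[OF N smooth_map_continuous_map[OF F] c d
      smooth_map_differentiable[OF F c d] this]
  show ?thesis
    by (simp add: differential_def Let_def tangent_map_component[OF N F c d v])
qed

lemma differential_cong:
  assumes p: "p \<in> points M" and h: "smooth_function M h"
    and eq: "\<And>x. x \<in> points M \<Longrightarrow> h x = k x"
  shows "differential M h p = differential M k p"
proof -
  have c: "some_chart M p \<in> charts_at M p" (is "?c \<in> _")
    using p by (rule some_chart_at)
  have "chart_deriv ?c h p = chart_deriv ?c k p"
  proof (rule chart_deriv_cong[OF c])
    show "(h \<circ> chart_inv ?c) differentiable (at (snd ?c p))"
      using h charts_atD[OF c] unfolding smooth_function_def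
      by (intro smooth_on_imp_differentiable[of "snd ?c ` fst ?c"]) auto
  qed (use eq subsetD[OF chart_domain_subset[OF charts_atD(1)[OF c]]] in blast)
  then show ?thesis by (simp add: differential_def fun_eq_iff)
qed

end


section \<open>Smooth maps from a product\<close>

lemma inv_into_map_prod:
  assumes "inj_on f A" "inj_on g B" "x \<in> f ` A" "y \<in> g ` B"
  shows "inv_into (A \<times> B) (map_prod f g) (x, y) = (inv_into A f x, inv_into B g y)"
proof (rule inv_into_f_eq)
  show "inj_on (map_prod f g) (A \<times> B)"
    using assms(1,2) by (auto simp: inj_on_def)
qed (use assms in \<open>auto simp: inv_into_into f_inv_into_f\<close>)

text \<open>
  The expression of a curried map in charts of its two arguments and of its value, on a subset of
  the product of the model spaces. Stated on pairs of points instead of through the charts of the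
  product manifold, it can be differentiated in each argument separately.
\<close>

definition pair_dom ::
  "('a, 'e) chart \<Rightarrow> ('b, 'f) chart \<Rightarrow> ('c, 'k) chart \<Rightarrow> ('a \<Rightarrow> 'b \<Rightarrow> 'c) \<Rightarrow> ('e \<times> 'f) set" where
  "pair_dom c d k \<Phi> = {(x, y). x \<in> snd c ` fst c \<and> y \<in> snd d ` fst d \<and>
     \<Phi> (chart_inv c x) (chart_inv d y) \<in> fst k}"

definition pair_rep ::
  "('a, 'e) chart \<Rightarrow> ('b, 'f) chart \<Rightarrow> ('c, 'k) chart \<Rightarrow> ('a \<Rightarrow> 'b \<Rightarrow> 'c) \<Rightarrow> 'e \<times> 'f \<Rightarrow> 'k" where
  "pair_rep c d k \<Phi> = (\<lambda>(x, y). snd k (\<Phi> (chart_inv c x) (chart_inv d y)))"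

locale smooth_pair_map =
  A: smooth_manifold A + B: smooth_manifold B + N: smooth_manifold N
  for A :: "('a, 'e::real_normed_vector) mfd" and B :: "('b, 'f::real_normed_vector) mfd"
    and N :: "('c, 'k::real_normed_vector) mfd" +
  fixes \<Phi> :: "'a \<Rightarrow> 'b \<Rightarrow> 'c"
  assumes smooth: "smooth_map (prod_mfd A B) N (\<lambda>(a, b). \<Phi> a b)"
begin

lemma continuous_pair_map:
  "continuous_map (prod_topology (topol A) (topol B)) (topol N) (\<lambda>(a, b). \<Phi> a b)"
  using smooth by (simp add: smooth_map_def prod_mfd_def)

lemma open_pair_dom:
  assumes c: "c \<in> atlas A" and d: "d \<in> atlas B" and k: "k \<in> atlas N"
  shows "open (pair_dom c d k \<Phi>)"
proof -
  let ?U = "(snd c ` fst c) \<times> (snd d ` fst d)"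
  let ?P = "\<lambda>z. (chart_inv c (fst z), chart_inv d (snd z))"
  have proj: "continuous_map (top_of_set ?U) (top_of_set (snd c ` fst c)) fst"
    "continuous_map (top_of_set ?U) (top_of_set (snd d ` fst d)) snd"
    by (auto intro!: continuous_intros)
  have "continuous_map (top_of_set ?U) (prod_topology (topol A) (topol B)) ?P"
    using continuous_map_compose[OF proj(1) A.continuous_map_chart_inv[OF c]]
      continuous_map_compose[OF proj(2) B.continuous_map_chart_inv[OF d]]
    by (intro continuous_map_pairedI) (simp_all only: comp_def)
  from continuous_map_compose[OF this continuous_pair_map]
  have "openin (top_of_set ?U)
      {z \<in> topspace (top_of_set ?U). ((\<lambda>(a, b). \<Phi> a b) \<circ> ?P) z \<in> fst k}"
    by (rule openin_continuous_map_preimage[OF _ N.chart_domain_open[OF k]])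
  moreover have "{z \<in> topspace (top_of_set ?U). ((\<lambda>(a, b). \<Phi> a b) \<circ> ?P) z \<in> fst k}
      = pair_dom c d k \<Phi>"
    by (auto simp: pair_dom_def)
  moreover have "open ?U"
    using A.chart_image_open[OF c] B.chart_image_open[OF d] by (rule open_Times)
  ultimately show ?thesis
    using openin_open_eq by metis
qed

lemma smooth_on_pair_rep:
  assumes c: "c \<in> atlas A" and d: "d \<in> atlas B" and k: "k \<in> atlas N"
  shows "smooth_on (pair_dom c d k \<Phi>) (pair_rep c d k \<Phi>)"
proof -
  let ?cd = "(fst c \<times> fst d, map_prod (snd c) (snd d))"
  have inv: "chart_inv ?cd (x, y) = (chart_inv c x, chart_inv d y)"
    if "x \<in> snd c ` fst c" "y \<in> snd d ` fst d" for x y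
    using inv_into_map_prod[OF A.chart_inj[OF c] B.chart_inj[OF d] that] by simp
  have "?cd \<in> atlas (prod_mfd A B)"
    unfolding prod_mfd_def using c d by (simp only: mfd.select_convs) blast
  then have "smooth_on (snd ?cd ` {p \<in> fst ?cd. (\<lambda>(a, b). \<Phi> a b) p \<in> fst k})
      (snd k \<circ> (\<lambda>(a, b). \<Phi> a b) \<circ> chart_inv ?cd)"
    using smooth k unfolding smooth_map_def by blast
  moreover have "snd ?cd ` {p \<in> fst ?cd. (\<lambda>(a, b). \<Phi> a b) p \<in> fst k} = pair_dom c d k \<Phi>"
  proof (rule Set.set_eqI)
    fix z :: "'e \<times> 'f"
    obtain x y where z: "z = (x, y)" by force
    show "z \<in> snd ?cd ` {p \<in> fst ?cd. (\<lambda>(a, b). \<Phi> a b) p \<in> fst k} \<longleftrightarrow> z \<in> pair_dom c d k \<Phi>"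
      using A.chart_inv_chart[OF c] B.chart_inv_chart[OF d]
      by (fastforce simp: z pair_dom_def)
  qed
  ultimately have "smooth_on (pair_dom c d k \<Phi>) (snd k \<circ> (\<lambda>(a, b). \<Phi> a b) \<circ> chart_inv ?cd)"
    by simp
  then show ?thesis
    by (rule smooth_on_cong[OF _ open_pair_dom[OF assms]])
      (auto simp: pair_dom_def pair_rep_def inv simp del: fst_conv snd_conv)
qed

lemma smooth_map_right:
  assumes a: "a \<in> points A"
  shows "smooth_map B N (\<Phi> a)"
  unfolding smooth_map_def
proof (intro conjI ballI)
  have "continuous_map (topol B) (prod_topology (topol A) (topol B)) (\<lambda>b. (a, b))"
    using a by (auto intro!: continuous_map_pairedI)
  from continuous_map_compose[OF this continuous_pair_map]
  show "continuous_map (topol B) (topol N) (\<Phi> a)" by (simp add: comp_def)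
next
  fix d k assume d: "d \<in> atlas B" and k: "k \<in> atlas N"
  obtain c where c: "c \<in> atlas A" "a \<in> fst c" using a unfolding A.charts_cover[symmetric] by blast
  let ?S = "(\<lambda>y. (snd c a, 0) + (0, y)) -` pair_dom c d k \<Phi>"
  have L: "bounded_linear (\<lambda>y::'f. (0::'e, y))"
    by (intro bounded_linear_Pair bounded_linear_zero bounded_linear_ident)
  have S: "?S = snd d ` {b \<in> fst d. \<Phi> a b \<in> fst k}"
    unfolding B.chart_image_Collect[OF d]
    using c A.chart_inv_chart[OF c] by (auto simp: pair_dom_def)
  have "open ?S"
    by (intro open_vimage open_pair_dom c d k continuous_intros)
  then show "smooth_on (snd d ` {b \<in> fst d. \<Phi> a b \<in> fst k}) (snd k \<circ> \<Phi> a \<circ> chart_inv d)"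
    using smooth_on_cong[OF smooth_on_compose_affine[OF smooth_on_pair_rep[OF c(1) d k]
          open_pair_dom[OF c(1) d k] L, of "(snd c a, 0)"], of "snd k \<circ> \<Phi> a \<circ> chart_inv d"]
    unfolding S by (simp add: pair_rep_def A.chart_inv_chart[OF c])
qed

lemma smooth_map_left:
  assumes b: "b \<in> points B"
  shows "smooth_map A N (\<lambda>a. \<Phi> a b)"
  unfolding smooth_map_def
proof (intro conjI ballI)
  have "continuous_map (topol A) (prod_topology (topol A) (topol B)) (\<lambda>a. (a, b))"
    using b by (auto intro!: continuous_map_pairedI)
  from continuous_map_compose[OF this continuous_pair_map]
  show "continuous_map (topol A) (topol N) (\<lambda>a. \<Phi> a b)" by (simp add: comp_def)
next
  fix c k assume c: "c \<in> atlas A" and k: "k \<in> atlas N"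
  obtain d where d: "d \<in> atlas B" "b \<in> fst d" using b unfolding B.charts_cover[symmetric] by blast
  let ?S = "(\<lambda>x. (0, snd d b) + (x, 0)) -` pair_dom c d k \<Phi>"
  have L: "bounded_linear (\<lambda>x::'e. (x, 0::'f))"
    by (intro bounded_linear_Pair bounded_linear_zero bounded_linear_ident)
  have S: "?S = snd c ` {a \<in> fst c. \<Phi> a b \<in> fst k}"
    unfolding A.chart_image_Collect[OF c]
    using d B.chart_inv_chart[OF d] by (auto simp: pair_dom_def)
  have "open ?S"
    by (intro open_vimage open_pair_dom c d k continuous_intros)
  then show "smooth_on (snd c ` {a \<in> fst c. \<Phi> a b \<in> fst k}) (snd k \<circ> (\<lambda>a. \<Phi> a b) \<circ> chart_inv c)"
    using smooth_on_cong[OF smooth_on_compose_affine[OF smooth_on_pair_rep[OF c d(1) k]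
          open_pair_dom[OF c d(1) k] L, of "(0, snd d b)"], of "snd k \<circ> (\<lambda>a. \<Phi> a b) \<circ> chart_inv c"]
    unfolding S by (simp add: pair_rep_def B.chart_inv_chart[OF d])
qed

end


section \<open>One-forms in charts\<close>

abbreviation form_rep ::
  "('a, 'e::real_normed_vector) mfd \<Rightarrow> ('a \<Rightarrow> ('a, 'e) tvec \<Rightarrow> real) \<Rightarrow> ('a, 'e) chart \<Rightarrow>
     'e \<Rightarrow> 'e \<Rightarrow> real" where
  "form_rep M \<theta> c w y \<equiv> \<theta> (chart_inv c y) (coord_tvec M c (chart_inv c y) w)"

lemma exterior_derivative_in_chart:
  "exterior_derivative M \<theta> p u v =
     frechet_derivative (form_rep M \<theta> (some_chart M p) (v (some_chart M p)))
       (at (snd (some_chart M p) p)) (u (some_chart M p)) -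
     frechet_derivative (form_rep M \<theta> (some_chart M p) (u (some_chart M p)))
       (at (snd (some_chart M p) p)) (v (some_chart M p))"
  by (simp add: exterior_derivative_def Let_def)

context smooth_manifold
begin

lemma charts_at_chart_inv:
  "c \<in> atlas M \<Longrightarrow> y \<in> snd c ` fst c \<Longrightarrow> c \<in> charts_at M (chart_inv c y)"
  by (simp add: charts_at_def inv_into_into)

lemma charts_at_in_points: "c \<in> charts_at M p \<Longrightarrow> p \<in> points M"
  using chart_domain_subset[OF charts_atD(1)] charts_atD(2) by (rule subsetD)

lemma form_rep_linear:
  assumes \<theta>: "smooth_one_form M \<theta>" and c: "c \<in> atlas M" and y: "y \<in> snd c ` fst c"
  shows "linear (\<lambda>w. form_rep M \<theta> c w y)"
proof -
  let ?p = "chart_inv c y"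
  have cp: "c \<in> charts_at M ?p" by (rule charts_at_chart_inv[OF c y])
  then have "?p \<in> points M" by (rule charts_at_in_points)
  then have "\<theta> ?p \<in> cotangent_space M ?p" using \<theta> by (simp add: smooth_one_form_def)
  then have "form_rep M \<theta> c (a *\<^sub>R u + b *\<^sub>R w) y = a * form_rep M \<theta> c u y + b * form_rep M \<theta> c w y"
    for a b u w
    unfolding coord_tvec_linear[OF cp] cotangent_space_def
    using coord_tvec_in_tangent_space[OF cp] by blast
  from this[of 1 _ 1] this[of _ _ 0] show ?thesis
    by (intro linearI) simp_all
qed

lemma form_rep_differentiable:
  assumes "smooth_one_form M \<theta>" "c \<in> atlas M" "y \<in> snd c ` fst c"
  shows "form_rep M \<theta> c w differentiable (at y)"
  using assms by (intro smooth_on_imp_differentiable[of "snd c ` fst c"])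
    (simp_all add: smooth_one_form_def)

lemma form_rep_has_derivative:
  assumes \<theta>: "smooth_one_form M \<theta>" and c: "c \<in> atlas M" and z: "a z \<in> snd c ` fst c"
    and a: "(a has_derivative a') (at z)" and b: "(b has_derivative b') (at z)"
  shows "((\<lambda>x. form_rep M \<theta> c (b x) (a x)) has_derivative
     (\<lambda>v. frechet_derivative (form_rep M \<theta> c (b z)) (at (a z)) (a' v)
        + form_rep M \<theta> c (b' v) (a z))) (at z)"
  by (rule has_derivative_linear_family[OF finite_dimensional chart_image_open[OF c] z
        form_rep_linear[OF \<theta> c] form_rep_differentiable[OF \<theta> c z] a b])

text \<open>
  The value of a one-form on a pushed-forward vector as a function of coordinates: only in this
  form can an invariance or pullback identity be differentiated.
\<close>

lemma form_rep_pullback: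
  assumes N: "smooth_manifold N" and F: "smooth_map M N F"
    and c: "c \<in> charts_at M p" and d: "d \<in> charts_at N (F p)"
  shows "\<eta> (F p) (tangent_map M N F p (coord_tvec M c p w)) =
    form_rep N \<eta> d (chart_deriv c (snd d \<circ> F) p w) (snd d (F p))"
  using tangent_map_in_chart[OF N F c d coord_tvec_in_tangent_space[OF c]]
    smooth_manifold.chart_inv_chart[OF N charts_atD[OF d]]
  by (simp add: coord_tvec_self[OF c])

lemma tangent_space_diff:
  assumes p: "p \<in> points M" and u: "u \<in> tangent_space M p" and v: "v \<in> tangent_space M p"
  shows "(\<lambda>c. u c - v c) \<in> tangent_space M p"
proof -
  have c: "some_chart M p \<in> charts_at M p" (is "?c \<in> _")
    by (rule some_chart_at[OF p])
  have "coord_tvec M ?c p (1 *\<^sub>R u ?c + (-1) *\<^sub>R v ?c) = (\<lambda>d. u d - v d)"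
    unfolding coord_tvec_linear[OF c] coord_tvec_of_component[OF c u]
      coord_tvec_of_component[OF c v] by simp
  then show ?thesis using coord_tvec_in_tangent_space[OF c] by metis
qed

lemma exterior_derivative_diff_left:
  assumes \<theta>: "smooth_one_form M \<theta>" and p: "p \<in> points M"
  shows "exterior_derivative M \<theta> p (\<lambda>c. u c - v c) w =
    exterior_derivative M \<theta> p u w - exterior_derivative M \<theta> p v w"
proof -
  have cp: "some_chart M p \<in> charts_at M p" (is "?c \<in> _")
    by (rule some_chart_at[OF p])
  note c = charts_atD[OF cp]
  let ?y = "snd ?c p" and ?\<Theta> = "form_rep M \<theta> ?c"
  have y: "?y \<in> snd ?c ` fst ?c" using c by blast
  note D = form_rep_differentiable[OF \<theta> c(1) y, unfolded frechet_derivative_works]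
  have "((\<lambda>y. ?\<Theta> (u ?c) y - ?\<Theta> (v ?c) y) has_derivative
     (\<lambda>k. frechet_derivative (?\<Theta> (u ?c)) (at ?y) k - frechet_derivative (?\<Theta> (v ?c)) (at ?y) k)) (at ?y)"
    by (rule has_derivative_diff[OF D D])
  then have "(?\<Theta> (u ?c - v ?c) has_derivative
     (\<lambda>k. frechet_derivative (?\<Theta> (u ?c)) (at ?y) k - frechet_derivative (?\<Theta> (v ?c)) (at ?y) k)) (at ?y)"
    by (rule has_derivative_transform_within_open[OF _ chart_image_open[OF c(1)] y])
      (rule linear_diff[OF form_rep_linear[OF \<theta> c(1)], symmetric])
  from fun_cong[OF frechet_derivative_at[OF this]]
  have "frechet_derivative (?\<Theta> (u ?c - v ?c)) (at ?y) k =
    frechet_derivative (?\<Theta> (u ?c)) (at ?y) k - frechet_derivative (?\<Theta> (v ?c)) (at ?y) k" for k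
    by (rule sym)
  moreover have "linear (frechet_derivative (?\<Theta> (w ?c)) (at ?y))"
    using form_rep_differentiable[OF \<theta> c(1) y] by (rule linear_frechet_derivative)
  ultimately show ?thesis
    using linear_diff[of "frechet_derivative (?\<Theta> (w ?c)) (at ?y)" "u ?c" "v ?c"]
    unfolding exterior_derivative_in_chart by (simp add: fun_diff_def)
qed

text \<open>
  In charts the pulled back form is
  \<open>y \<mapsto> \<eta>(\<psi> y)(D\<psi>(y) w)\<close>; its derivative in direction \<open>v\<close> has the extra term
  \<open>\<eta>(\<psi> y)(D\<^sup>2\<psi>(y)(v, w))\<close>, which is symmetric and drops out of \<open>d\<close>.
\<close>

lemma exterior_derivative_pullback:
  assumes N: "smooth_manifold N" and F: "smooth_map M N F" and \<eta>: "smooth_one_form N \<eta>"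
    and pull: "\<And>q v. q \<in> points M \<Longrightarrow> v \<in> tangent_space M q \<Longrightarrow>
      \<eta> (F q) (tangent_map M N F q v) = \<theta> q v"
    and p: "p \<in> points M" and u: "u \<in> tangent_space M p" and v: "v \<in> tangent_space M p"
  shows "exterior_derivative N \<eta> (F p) (tangent_map M N F p u) (tangent_map M N F p v) =
    exterior_derivative M \<theta> p u v"
proof -
  interpret N: smooth_manifold N by (rule N)
  have cp: "some_chart M p \<in> charts_at M p" (is "?c \<in> _")
    by (rule some_chart_at[OF p])
  have dFp: "some_chart N (F p) \<in> charts_at N (F p)" (is "?d \<in> _")
    by (rule N.some_chart_at[OF smooth_map_in_points[OF F p]])
  note c = charts_atD[OF cp] and d = charts_atD[OF dFp]
  define \<psi> where "\<psi> = snd ?d \<circ> F \<circ> chart_inv ?c"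
  define S where "S = snd ?c ` {q \<in> fst ?c. F q \<in> fst ?d}"
  let ?y = "snd ?c p" and ?\<Theta> = "form_rep M \<theta> ?c" and ?H = "form_rep N \<eta> ?d"
  have "openin (topol M) {q \<in> points M. F q \<in> fst ?d}"
    by (rule openin_continuous_map_preimage[OF smooth_map_continuous_map[OF F] N.chart_domain_open[OF d(1)]])
  then have "open (snd ?c ` (fst ?c \<inter> {q \<in> points M. F q \<in> fst ?d}))"
    by (rule open_chart_image_Int[OF c(1)])
  moreover have "fst ?c \<inter> {q \<in> points M. F q \<in> fst ?d} = {q \<in> fst ?c. F q \<in> fst ?d}"
    using chart_domain_subset[OF c(1)] by blast
  ultimately have S: "open S" "?y \<in> S" using c d by (auto simp: S_def)
  have \<psi>: "smooth_on S \<psi>"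
    using F c(1) d(1) unfolding smooth_map_def S_def \<psi>_def by blast
  have \<psi>y: "\<psi> ?y = snd ?d (F p)" by (simp add: \<psi>_def chart_inv_chart[OF c])
  have pulled: "?\<Theta> w y = ?H (frechet_derivative \<psi> (at y) w) (\<psi> y)" if "y \<in> S" for w y
  proof -
    let ?q = "chart_inv ?c y"
    have y: "y \<in> snd ?c ` fst ?c" "F ?q \<in> fst ?d"
      using that chart_inv_chart[OF c(1)] by (auto simp: S_def)
    have cq: "?c \<in> charts_at M ?q" and dq: "?d \<in> charts_at N (F ?q)"
      using charts_at_chart_inv[OF c(1) y(1)] y d by (auto simp: charts_at_def)
    from cq have "?q \<in> points M" by (rule charts_at_in_points)
    then have "?\<Theta> w y = \<eta> (F ?q) (tangent_map M N F ?q (coord_tvec M ?c ?q w))"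
      using pull coord_tvec_in_tangent_space[OF cq] by simp
    also have "\<dots> = ?H (chart_deriv ?c (snd ?d \<circ> F) ?q w) (snd ?d (F ?q))"
      by (rule form_rep_pullback[OF N F cq dq])
    also have "snd ?c ?q = y" using y(1) by (rule f_inv_into_f)
    finally show ?thesis by (simp add: \<psi>_def comp_def)
  qed
  have D: "frechet_derivative (?\<Theta> w) (at ?y) k =
      frechet_derivative (?H (frechet_derivative \<psi> (at ?y) w)) (at (\<psi> ?y)) (frechet_derivative \<psi> (at ?y) k)
      + ?H (frechet_derivative (\<lambda>y. frechet_derivative \<psi> (at y) w) (at ?y) k) (\<psi> ?y)" for w k
  proof -
    have "((\<lambda>y. ?H (frechet_derivative \<psi> (at y) w) (\<psi> y)) has_derivative
       (\<lambda>k. frechet_derivative (?H (frechet_derivative \<psi> (at ?y) w)) (at (\<psi> ?y)) (frechet_derivative \<psi> (at ?y) k)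
        + ?H (frechet_derivative (\<lambda>y. frechet_derivative \<psi> (at y) w) (at ?y) k) (\<psi> ?y))) (at ?y)"
      by (rule N.form_rep_has_derivative[OF \<eta> d(1)])
        (use \<psi>y d smooth_on_has_derivative[OF \<psi> S(2)]
          smooth_on_has_derivative[OF smooth_on_frechet_derivative[OF \<psi>] S(2)] in auto)
    then have "(?\<Theta> w has_derivative
       (\<lambda>k. frechet_derivative (?H (frechet_derivative \<psi> (at ?y) w)) (at (\<psi> ?y)) (frechet_derivative \<psi> (at ?y) k)
        + ?H (frechet_derivative (\<lambda>y. frechet_derivative \<psi> (at y) w) (at ?y) k) (\<psi> ?y))) (at ?y)"
      by (rule has_derivative_transform_within_open[OF _ S]) (rule pulled[symmetric])
    from fun_cong[OF frechet_derivative_at[OF this], of k] show ?thesis by (rule sym)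
  qed
  have comp: "tangent_map M N F p x ?d = frechet_derivative \<psi> (at ?y) (x ?c)"
    if "x \<in> tangent_space M p" for x
    unfolding \<psi>_def by (rule tangent_map_component[OF N F cp dFp that])
  show ?thesis
    unfolding exterior_derivative_in_chart comp[OF u] comp[OF v] D \<psi>y[symmetric]
      smooth_on_mixed_derivatives_commute[OF \<psi> S, of "u ?c" "v ?c"]
    by simp
qed

end

lemma exact_symplectic_eqI:
  assumes "exact_symplectic M \<theta> \<omega>" and p: "p \<in> points M"
    and u: "u \<in> tangent_space M p" and v: "v \<in> tangent_space M p"
    and eq: "\<And>w. w \<in> tangent_space M p \<Longrightarrow> \<omega> p u w = \<omega> p v w"
  shows "u = v"
proof -
  have M: "smooth_manifold M" and \<theta>: "smooth_one_form M \<theta>"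
    and \<omega>: "\<And>u w. u \<in> tangent_space M p \<Longrightarrow> w \<in> tangent_space M p \<Longrightarrow>
      \<omega> p u w = - exterior_derivative M \<theta> p u w"
    and nondeg: "\<And>u. u \<in> tangent_space M p \<Longrightarrow>
      (\<forall>w\<in>tangent_space M p. \<omega> p u w = 0) \<Longrightarrow> u = (\<lambda>_. 0)"
    using assms(1) p unfolding exact_symplectic_def by blast+
  interpret smooth_manifold M by (rule M)
  have diff: "(\<lambda>c. u c - v c) \<in> tangent_space M p"
    by (rule tangent_space_diff[OF p u v])
  have "\<omega> p (\<lambda>c. u c - v c) w = 0" if "w \<in> tangent_space M p" for w
    using eq[OF that] that \<omega> u v diff exterior_derivative_diff_left[OF \<theta> p] by simp
  then have "(\<lambda>c. u c - v c) = (\<lambda>_. 0)" using nondeg[OF diff] by blast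
  then show ?thesis by (simp add: fun_eq_iff)
qed


section \<open>Lie group actions and the momentum map\<close>

lemma smooth_on_const: "smooth_on S (\<lambda>_. k)"
proof -
  have "Ck_on n S (\<lambda>_. k)" for n
    by (induction n arbitrary: k) auto
  then show ?thesis by (simp add: smooth_on_def)
qed

lemma has_derivative_Pair_left:
  "(f has_derivative D) (at (a, b)) \<Longrightarrow> ((\<lambda>x. f (x, b)) has_derivative (\<lambda>k. D (k, 0))) (at a)"
  by (rule has_derivative_compose[of "\<lambda>x. (x, b)"]) (auto intro!: derivative_eq_intros)

lemma has_derivative_Pair_right:
  "(f has_derivative D) (at (a, b)) \<Longrightarrow> ((\<lambda>y. f (a, y)) has_derivative (\<lambda>k. D (0, k))) (at b)"
  by (rule has_derivative_compose[of "\<lambda>y. (a, y)"]) (auto intro!: derivative_eq_intros)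

locale lie_group_action = lie_group \<G> G + smooth_manifold M
  for \<G> :: "'g monoid" and G :: "('g, 'h::real_normed_vector) mfd"
    and M :: "('a, 'e::real_normed_vector) mfd" +
  fixes \<Phi> :: "'g \<Rightarrow> 'a \<Rightarrow> 'a"
  assumes smooth_action: "smooth_action \<G> G M \<Phi>"
begin

sublocale G: smooth_manifold G by (rule is_manifold)

sublocale action: group_action \<G> "points M" \<Phi>
  using smooth_action by (simp add: smooth_action_def)

sublocale pair: smooth_pair_map G M M \<Phi>
  using smooth_action by unfold_locales (simp add: smooth_action_def)

lemma one_in_points: "\<one>\<^bsub>\<G>\<^esub> \<in> points G"
  using group.is_monoid[OF is_group] carrier_eq_points monoid.one_closed by blast

lemma action_one: "p \<in> points M \<Longrightarrow> \<Phi> \<one>\<^bsub>\<G>\<^esub> p = p"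
  using action.id_eq_one by (metis restrict_apply')

lemma smooth_translation: "g \<in> carrier \<G> \<Longrightarrow> smooth_map M M (\<Phi> g)"
  using pair.smooth_map_right carrier_eq_points by simp

lemma translation_in_points: "g \<in> carrier \<G> \<Longrightarrow> p \<in> points M \<Longrightarrow> \<Phi> g p \<in> points M"
  by (rule smooth_map_in_points[OF smooth_translation])

lemma translation_inv:
  assumes g: "g \<in> carrier \<G>" and p: "p \<in> points M"
  shows "\<Phi> (inv\<^bsub>\<G>\<^esub> g) (\<Phi> g p) = p" "\<Phi> g (\<Phi> (inv\<^bsub>\<G>\<^esub> g) p) = p"
proof -
  interpret group \<G> by (rule is_group)
  show "\<Phi> (inv\<^bsub>\<G>\<^esub> g) (\<Phi> g p) = p"
    using action.composition_rule[OF p inv_closed[OF g] g] action_one[OF p] g by simp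
  show "\<Phi> g (\<Phi> (inv\<^bsub>\<G>\<^esub> g) p) = p"
    using action.composition_rule[OF p g inv_closed[OF g]] action_one[OF p] g by simp
qed

lemma infinitesimal_generator_tangent:
  assumes "\<xi> \<in> lie_algebra \<G> G" and p: "p \<in> points M"
  shows "infinitesimal_generator \<G> G M \<Phi> \<xi> p \<in> tangent_space M p"
  using G.tangent_map_in_tangent_space[OF smooth_manifold_axioms pair.smooth_map_left[OF p]
      one_in_points assms(1)] action_one[OF p]
  by (simp add: infinitesimal_generator_def)

lemma differential_invariant_generator:
  assumes h: "smooth_function M h" and inv: "invariant_function \<G> M \<Phi> h"
    and \<xi>: "\<xi> \<in> lie_algebra \<G> G" and p: "p \<in> points M"
  shows "differential M h p (infinitesimal_generator \<G> G M \<Phi> \<xi> p) = 0"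
proof -
  have "differential M h p (infinitesimal_generator \<G> G M \<Phi> \<xi> p) =
      differential G (h \<circ> (\<lambda>g. \<Phi> g p)) \<one>\<^bsub>\<G>\<^esub> \<xi>"
    using G.differential_tangent_map[OF smooth_manifold_axioms pair.smooth_map_left[OF p] h
        one_in_points \<xi>] action_one[OF p]
    by (simp add: infinitesimal_generator_def)
  also have "\<dots> = differential G (\<lambda>_. h p) \<one>\<^bsub>\<G>\<^esub> \<xi>"
  proof (rule fun_cong[OF G.differential_cong[symmetric]])
    show "smooth_function G (\<lambda>_. h p)"
      by (simp add: smooth_function_def comp_def smooth_on_const)
    show "h p = (h \<circ> (\<lambda>g. \<Phi> g p)) g" if "g \<in> points G" for g
      using inv that p carrier_eq_points by (simp add: invariant_function_def)
  qed (rule one_in_points)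
  also have "\<dots> = 0" by (simp add: differential_def comp_def Let_def)
  finally show ?thesis .
qed

text \<open>
  The identity \<open>dJ\<^sub>\<xi> = - i\<^bsub>\<xi>\<^sub>M\<^esub> d\<theta>\<close>, that is, Cartan's formula for \<open>L\<^bsub>\<xi>\<^sub>M\<^esub> \<theta> = 0\<close>. In
  coordinates, with \<open>\<phi>(h, y)\<close> the action in charts, \<open>J\<^sub>\<xi>\<close> is \<open>y \<mapsto> \<theta>(y)(D\<^sub>\<zeta> \<phi>(1, y))\<close>, and
  invariance reads \<open>\<theta>(\<phi>(h, y))(D\<^sub>w \<phi>(h, y)) = \<theta>(y)(w)\<close>. Differentiating the former along \<open>w\<close> and
  the latter along \<open>\<zeta>\<close> gives the same term with a mixed derivative of \<open>\<phi>\<close>.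
\<close>

lemma momentum_map_derivative:
  assumes \<theta>: "smooth_one_form M \<theta>" and inv: "invariant_one_form \<G> M \<Phi> \<theta>"
    and \<xi>: "\<xi> \<in> lie_algebra \<G> G" and p: "p \<in> points M"
  shows "((\<lambda>y. momentum_map \<G> G M \<Phi> \<theta> (chart_inv (some_chart M p) y) \<xi>) has_derivative
    (\<lambda>w. exterior_derivative M \<theta> p (coord_tvec M (some_chart M p) p w)
       (infinitesimal_generator \<G> G M \<Phi> \<xi> p))) (at (snd (some_chart M p) p))"
proof -
  have cp: "some_chart M p \<in> charts_at M p" (is "?c \<in> _")
    by (rule some_chart_at[OF p])
  have e1: "some_chart G \<one>\<^bsub>\<G>\<^esub> \<in> charts_at G \<one>\<^bsub>\<G>\<^esub>" (is "?e \<in> _")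
    by (rule G.some_chart_at[OF one_in_points])
  note c = charts_atD[OF cp] and e = charts_atD[OF e1]
  define W where "W = pair_dom ?e ?c ?c \<Phi>"
  define \<phi> where "\<phi> = pair_rep ?e ?c ?c \<Phi>"
  define U where "U = snd ?c ` fst ?c"
  let ?h = "snd ?e \<one>\<^bsub>\<G>\<^esub>" and ?y = "snd ?c p" and ?\<zeta> = "\<xi> ?e" and ?\<Theta> = "form_rep M \<theta> ?c"
  define K where "K y = frechet_derivative \<phi> (at (?h, y)) (?\<zeta>, 0)" for y
  have W: "open W" and \<phi>: "smooth_on W \<phi>"
    unfolding W_def \<phi>_def
    by (rule pair.open_pair_dom[OF e(1) c(1) c(1)] pair.smooth_on_pair_rep[OF e(1) c(1) c(1)])+
  have U: "open U" "?y \<in> U" using chart_image_open[OF c(1)] c by (auto simp: U_def)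
  note e_inv = G.chart_inv_chart[OF e] and c_inv = chart_inv_chart[OF c]
  have q: "chart_inv ?c y \<in> points M" "?c \<in> charts_at M (chart_inv ?c y)"
    "snd ?c (chart_inv ?c y) = y" if "y \<in> U" for y
  proof -
    show "?c \<in> charts_at M (chart_inv ?c y)"
      using that unfolding U_def by (rule charts_at_chart_inv[OF c(1)])
    then show "chart_inv ?c y \<in> points M"
      by (rule charts_at_in_points)
    show "snd ?c (chart_inv ?c y) = y"
      using that unfolding U_def by (rule f_inv_into_f)
  qed
  have \<phi>_one: "\<phi> (?h, y) = y" if "y \<in> U" for y
    using q[OF that] by (simp add: \<phi>_def pair_rep_def e_inv action_one)
  have hW: "(?h, y) \<in> W" if "y \<in> U" for y
    using that q[OF that] charts_atD(2)[OF q(2)[OF that]] e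
    by (simp add: W_def pair_dom_def e_inv action_one U_def)
  have D\<phi>: "(\<phi> has_derivative frechet_derivative \<phi> (at z)) (at z)" if "z \<in> W" for z
    by (rule smooth_on_has_derivative[OF \<phi> that])
  have D2\<phi>: "((\<lambda>z. frechet_derivative \<phi> (at z) k) has_derivative
      frechet_derivative (\<lambda>z. frechet_derivative \<phi> (at z) k) (at z)) (at z)" if "z \<in> W" for z k
    by (rule smooth_on_has_derivative[OF smooth_on_frechet_derivative[OF \<phi>] that])

  have gen: "infinitesimal_generator \<G> G M \<Phi> \<xi> (chart_inv ?c y) =
      coord_tvec M ?c (chart_inv ?c y) (K y)" if y: "y \<in> U" for y
  proof -
    let ?q = "chart_inv ?c y"
    have "?c \<in> charts_at M (\<Phi> \<one>\<^bsub>\<G>\<^esub> ?q)" using q[OF y] action_one by simp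
    from G.tangent_map_in_chart[OF smooth_manifold_axioms pair.smooth_map_left[OF q(1)[OF y]] e1 this \<xi>]
    have "infinitesimal_generator \<G> G M \<Phi> \<xi> ?q =
        coord_tvec M ?c ?q (chart_deriv ?e (snd ?c \<circ> (\<lambda>g. \<Phi> g ?q)) \<one>\<^bsub>\<G>\<^esub> ?\<zeta>)"
      by (simp add: infinitesimal_generator_def action_one q[OF y])
    also have "snd ?c \<circ> (\<lambda>g. \<Phi> g ?q) \<circ> chart_inv ?e = (\<lambda>h. \<phi> (h, y))"
      by (simp add: \<phi>_def pair_rep_def comp_def)
    also have "frechet_derivative (\<lambda>h. \<phi> (h, y)) (at ?h) ?\<zeta> = K y"
      unfolding K_def
      by (rule fun_cong[OF frechet_derivative_at[OF has_derivative_Pair_left[OF D\<phi>[OF hW[OF y]]]], symmetric])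
    finally show ?thesis .
  qed
  have J: "momentum_map \<G> G M \<Phi> \<theta> (chart_inv ?c y) \<xi> = ?\<Theta> (K y) y" if "y \<in> U" for y
    using \<xi> by (simp add: momentum_map_def gen[OF that])

  have invariance: "?\<Theta> w ?y = ?\<Theta> (frechet_derivative \<phi> (at (h, ?y)) (0, w)) (\<phi> (h, ?y))"
    if h: "(h, ?y) \<in> W" for h w
  proof -
    let ?g = "chart_inv ?e h"
    have hU: "h \<in> snd ?e ` fst ?e" "\<Phi> ?g p \<in> fst ?c"
      using h by (auto simp: W_def pair_dom_def c_inv)
    have "?g \<in> fst ?e" using hU(1) by (rule inv_into_into)
    then have g: "?g \<in> carrier \<G>"
      using G.chart_domain_subset[OF e(1)] carrier_eq_points by blast
    have cg: "?c \<in> charts_at M (\<Phi> ?g p)" using hU c by (simp add: charts_at_def)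
    have "?\<Theta> w ?y = \<theta> (\<Phi> ?g p) (tangent_map M M (\<Phi> ?g) p (coord_tvec M ?c p w))"
      using inv g p coord_tvec_in_tangent_space[OF cp]
      by (simp add: invariant_one_form_def c_inv)
    also have "\<dots> = ?\<Theta> (chart_deriv ?c (snd ?c \<circ> \<Phi> ?g) p w) (snd ?c (\<Phi> ?g p))"
      by (rule form_rep_pullback[OF smooth_manifold_axioms smooth_translation[OF g] cp cg])
    also have "snd ?c (\<Phi> ?g p) = \<phi> (h, ?y)"
      by (simp add: \<phi>_def pair_rep_def c_inv)
    also have "snd ?c \<circ> \<Phi> ?g \<circ> chart_inv ?c = (\<lambda>y. \<phi> (h, y))"
      by (simp add: \<phi>_def pair_rep_def comp_def)
    also have "frechet_derivative (\<lambda>y. \<phi> (h, y)) (at ?y) w = frechet_derivative \<phi> (at (h, ?y)) (0, w)"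
      by (rule fun_cong[OF frechet_derivative_at[OF has_derivative_Pair_right[OF D\<phi>[OF h]]], symmetric])
    finally show ?thesis .
  qed

  let ?z = "(?h, ?y)"
  let ?mix = "\<lambda>w. frechet_derivative (\<lambda>z. frechet_derivative \<phi> (at z) (0, w)) (at ?z) (?\<zeta>, 0)"
  have z: "?z \<in> W" by (rule hW[OF U(2)])
  have D\<phi>_one: "frechet_derivative \<phi> (at ?z) (0, w) = w" for w
  proof -
    have "((\<lambda>y. y) has_derivative (\<lambda>k. frechet_derivative \<phi> (at ?z) (0, k))) (at ?y)"
      by (rule has_derivative_transform_within_open[OF has_derivative_Pair_right[OF D\<phi>[OF z]] U])
        (rule \<phi>_one)
    from fun_cong[OF has_derivative_unique[OF this has_derivative_ident], of w] show ?thesis .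
  qed
  have infinitesimal: "frechet_derivative (?\<Theta> w) (at ?y) (K ?y) + ?\<Theta> (?mix w) ?y = 0" for w
  proof -
    have L: "((\<lambda>h. ?\<Theta> (frechet_derivative \<phi> (at (h, ?y)) (0, w)) (\<phi> (h, ?y))) has_derivative
      (\<lambda>k. frechet_derivative (?\<Theta> (frechet_derivative \<phi> (at ?z) (0, w))) (at (\<phi> ?z))
             (frechet_derivative \<phi> (at ?z) (k, 0))
         + ?\<Theta> (frechet_derivative (\<lambda>z. frechet_derivative \<phi> (at z) (0, w)) (at ?z) (k, 0)) (\<phi> ?z)))
      (at ?h)"
      by (rule form_rep_has_derivative[OF \<theta> c(1) _ has_derivative_Pair_left[OF D\<phi>[OF z]]
            has_derivative_Pair_left[OF D2\<phi>[OF z]]])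
        (use U \<phi>_one in \<open>simp add: U_def\<close>)
    have V: "open ((\<lambda>h. (h, ?y)) -` W)"
      by (intro open_vimage W continuous_intros)
    have "((\<lambda>h. ?\<Theta> w ?y) has_derivative
      (\<lambda>k. frechet_derivative (?\<Theta> (frechet_derivative \<phi> (at ?z) (0, w))) (at (\<phi> ?z))
             (frechet_derivative \<phi> (at ?z) (k, 0))
         + ?\<Theta> (frechet_derivative (\<lambda>z. frechet_derivative \<phi> (at z) (0, w)) (at ?z) (k, 0)) (\<phi> ?z)))
      (at ?h)"
      by (rule has_derivative_transform_within_open[OF L V]) (use z invariance in auto)
    from fun_cong[OF has_derivative_unique[OF this has_derivative_const], of ?\<zeta>]
    show ?thesis unfolding D\<phi>_one \<phi>_one[OF U(2)] K_def .
  qed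

  (* The derivatives of phi along the group and along M are interchanged here, which matches
     this derivative with the one produced by the infinitesimal invariance of the form. *)
  have DK: "(K has_derivative ?mix) (at ?y)"
    using has_derivative_Pair_right[OF D2\<phi>[OF z, of "(?\<zeta>, 0)"]]
    unfolding K_def smooth_on_mixed_derivatives_commute[OF \<phi> W z, of "(?\<zeta>, 0)"] .
  have "((\<lambda>y. ?\<Theta> (K y) y) has_derivative
      (\<lambda>w. frechet_derivative (?\<Theta> (K ?y)) (at ?y) w + ?\<Theta> (?mix w) ?y)) (at ?y)"
    by (rule form_rep_has_derivative[OF \<theta> c(1) _ has_derivative_ident DK])
      (use U in \<open>simp add: U_def\<close>)
  then have deriv: "((\<lambda>y. momentum_map \<G> G M \<Phi> \<theta> (chart_inv ?c y) \<xi>) has_derivative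
      (\<lambda>w. frechet_derivative (?\<Theta> (K ?y)) (at ?y) w + ?\<Theta> (?mix w) ?y)) (at ?y)"
    by (rule has_derivative_transform_within_open[OF _ U]) (rule J[symmetric])
  have "infinitesimal_generator \<G> G M \<Phi> \<xi> p ?c = K ?y"
    using gen[OF U(2)] coord_tvec_self[OF cp] by (simp add: c_inv)
  then have "exterior_derivative M \<theta> p (coord_tvec M ?c p w) (infinitesimal_generator \<G> G M \<Phi> \<xi> p) =
      frechet_derivative (?\<Theta> (K ?y)) (at ?y) w - frechet_derivative (?\<Theta> w) (at ?y) (K ?y)" for w
    by (simp add: exterior_derivative_in_chart coord_tvec_self[OF cp])
  also have "frechet_derivative (?\<Theta> (K ?y)) (at ?y) w - frechet_derivative (?\<Theta> w) (at ?y) (K ?y) =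
      frechet_derivative (?\<Theta> (K ?y)) (at ?y) w + ?\<Theta> (?mix w) ?y" for w
    using infinitesimal[of w] by simp
  finally show ?thesis using deriv by presburger
qed

text \<open>
  A form-preserving symmetry carries \<open>X\<close> to a solution of the defining equation at the image point,
  and nondegeneracy makes this solution unique.
\<close>

lemma conformal_Hamiltonian_vf_invariant:
  assumes sympl: "exact_symplectic M \<theta> \<omega>" and inv: "invariant_one_form \<G> M \<Phi> \<theta>"
    and H: "invariant_function \<G> M \<Phi> H" and f: "invariant_function \<G> M \<Phi> f"
    and X: "conformal_Hamiltonian_vf M \<theta> \<omega> f H X"
  shows "invariant_vector_field \<G> M \<Phi> X"
  unfolding invariant_vector_field_def
proof (intro ballI)
  fix g p assume g: "g \<in> carrier \<G>" and p: "p \<in> points M"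
  have \<theta>: "smooth_one_form M \<theta>"
    and \<omega>: "\<And>p u w. p \<in> points M \<Longrightarrow> u \<in> tangent_space M p \<Longrightarrow> w \<in> tangent_space M p \<Longrightarrow>
      \<omega> p u w = - exterior_derivative M \<theta> p u w"
    using sympl unfolding exact_symplectic_def by blast+
  have smooth_H: "smooth_function M H"
    and X_tangent: "\<And>p. p \<in> points M \<Longrightarrow> X p \<in> tangent_space M p"
    and X_eq: "\<And>p v. p \<in> points M \<Longrightarrow> v \<in> tangent_space M p \<Longrightarrow>
      \<omega> p (X p) v = differential M H p v - f p * \<theta> p v"
    using X unfolding conformal_Hamiltonian_vf_def smooth_vector_field_def interior_product_def
    by blast+
  note F = smooth_translation[OF g]
  note gp = translation_in_points[OF g p]
  let ?T = "tangent_map M M (\<Phi> g) p"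
  have pull: "\<theta> (\<Phi> g q) (tangent_map M M (\<Phi> g) q v) = \<theta> q v"
    if "q \<in> points M" "v \<in> tangent_space M q" for q v
    using inv g that by (simp add: invariant_one_form_def)
  have T: "?T u \<in> tangent_space M (\<Phi> g p)" if "u \<in> tangent_space M p" for u
    by (rule tangent_map_in_tangent_space[OF smooth_manifold_axioms F p that])
  show "?T (X p) = X (\<Phi> g p)"
  proof (rule exact_symplectic_eqI[OF sympl gp T[OF X_tangent[OF p]] X_tangent[OF gp]])
    fix w assume w: "w \<in> tangent_space M (\<Phi> g p)"
    have g': "inv\<^bsub>\<G>\<^esub> g \<in> carrier \<G>" by (rule group.inv_closed[OF is_group g])
    note F' = smooth_translation[OF g']
    (* Every tangent vector at the image point is pushed forward from p, so that both sides can be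
       compared with the equation that X satisfies at p. *)
    define v where "v = tangent_map M M (\<Phi> (inv\<^bsub>\<G>\<^esub> g)) (\<Phi> g p) w"
    have v: "v \<in> tangent_space M p"
      using tangent_map_in_tangent_space[OF smooth_manifold_axioms F' gp w]
      by (simp add: v_def translation_inv[OF g p])
    have Tv: "?T v = w"
      using tangent_map_left_inverse[OF smooth_manifold_axioms F' F translation_inv(2)[OF g] gp w]
      by (simp add: v_def translation_inv[OF g p])
    have "\<omega> (\<Phi> g p) (?T (X p)) (?T v) = \<omega> p (X p) v"
      using exterior_derivative_pullback[OF smooth_manifold_axioms F \<theta> pull p X_tangent[OF p] v]
        \<omega>[OF p X_tangent[OF p] v] \<omega>[OF gp T[OF X_tangent[OF p]] T[OF v]] by simp
    also have "\<dots> = differential M H p v - f p * \<theta> p v" by (rule X_eq[OF p v])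
    also have "differential M H p v = differential M (H \<circ> \<Phi> g) p v"
      by (rule fun_cong[OF differential_cong[OF p smooth_H]])
        (use H g in \<open>simp add: invariant_function_def\<close>)
    also have "\<dots> = differential M H (\<Phi> g p) (?T v)"
      by (rule differential_tangent_map[OF smooth_manifold_axioms F smooth_H p v, symmetric])
    also have "f p * \<theta> p v = f (\<Phi> g p) * \<theta> (\<Phi> g p) (?T v)"
      using f g p pull[OF p v] by (simp add: invariant_function_def)
    also have "differential M H (\<Phi> g p) (?T v) - \<dots> = \<omega> (\<Phi> g p) (X (\<Phi> g p)) (?T v)"
      by (rule X_eq[OF gp T[OF v], symmetric])
    finally show "\<omega> (\<Phi> g p) (?T (X p)) w = \<omega> (\<Phi> g p) (X (\<Phi> g p)) w"
      by (simp add: Tv)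
  qed
qed

end


section \<open>Momentum along integral curves\<close>

text \<open>
  Along an integral curve each component of the momentum solves \<open>j' = f j\<close>, since
  \<open>X(J\<^sub>\<xi>) = d\<theta>(X, \<xi>\<^sub>M) = -\<omega>(X, \<xi>\<^sub>M) = f \<theta>(\<xi>\<^sub>M) - dH(\<xi>\<^sub>M)\<close> and \<open>H\<close> is constant on orbits.
\<close>

lemma (in lie_group_action) momentum_map_along_integral_curve:
  assumes sympl: "exact_symplectic M \<theta> \<omega>" and inv: "invariant_one_form \<G> M \<Phi> \<theta>"
    and H: "invariant_function \<G> M \<Phi> H"
    and X: "conformal_Hamiltonian_vf M \<theta> \<omega> f H X"
    and x: "integral_curve M X I x" and t: "t \<in> I" and \<xi>: "\<xi> \<in> lie_algebra \<G> G"
  shows "((\<lambda>s. momentum_map \<G> G M \<Phi> \<theta> (x s) \<xi>) has_real_derivative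
    f (x t) * momentum_map \<G> G M \<Phi> \<theta> (x t) \<xi>) (at t)"
proof -
  have \<theta>: "smooth_one_form M \<theta>"
    and \<omega>: "\<And>p u w. p \<in> points M \<Longrightarrow> u \<in> tangent_space M p \<Longrightarrow> w \<in> tangent_space M p \<Longrightarrow>
      \<omega> p u w = - exterior_derivative M \<theta> p u w"
    using sympl unfolding exact_symplectic_def by blast+
  have smooth_H: "smooth_function M H"
    and X_tangent: "\<And>p. p \<in> points M \<Longrightarrow> X p \<in> tangent_space M p"
    and X_eq: "\<And>p v. p \<in> points M \<Longrightarrow> v \<in> tangent_space M p \<Longrightarrow>
      \<omega> p (X p) v = differential M H p v - f p * \<theta> p v"
    using X unfolding conformal_Hamiltonian_vf_def smooth_vector_field_def interior_product_def
    by blast+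
  have I: "open I" and cont: "continuous_map (top_of_set I) (topol M) x"
    and x': "\<And>c. c \<in> charts_at M (x t) \<Longrightarrow> ((\<lambda>s. snd c (x s)) has_vector_derivative X (x t) c) (at t)"
    using x t unfolding integral_curve_def by blast+
  let ?p = "x t"
  have p: "?p \<in> points M"
    using continuous_map_funspace[OF cont] t by auto
  have cp: "some_chart M ?p \<in> charts_at M ?p" (is "?c \<in> _")
    by (rule some_chart_at[OF p])
  note c = charts_atD[OF cp]
  let ?J = "momentum_map \<G> G M \<Phi> \<theta>" and ?gen = "infinitesimal_generator \<G> G M \<Phi> \<xi> ?p"
  note gen = infinitesimal_generator_tangent[OF \<xi> p]
  have "((\<lambda>s. ?J (chart_inv ?c (snd ?c (x s))) \<xi>) has_derivative
      (\<lambda>r. exterior_derivative M \<theta> ?p (coord_tvec M ?c ?p (r *\<^sub>R X ?p ?c)) ?gen)) (at t)"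
    by (rule has_derivative_compose[OF x'[OF cp, unfolded has_vector_derivative_def]
          momentum_map_derivative[OF \<theta> inv \<xi> p]])
  moreover have "open {s \<in> I. x s \<in> fst ?c}"
    using openin_continuous_map_preimage[OF cont chart_domain_open[OF c(1)]] I
    by (simp add: openin_open_eq)
  ultimately have deriv: "((\<lambda>s. ?J (x s) \<xi>) has_derivative
      (\<lambda>r. exterior_derivative M \<theta> ?p (coord_tvec M ?c ?p (r *\<^sub>R X ?p ?c)) ?gen)) (at t)"
    by (rule has_derivative_transform_within_open) (use t c chart_inv_chart in auto)
  have "exterior_derivative M \<theta> ?p (coord_tvec M ?c ?p (1 *\<^sub>R X ?p ?c)) ?gen =
      - \<omega> ?p (X ?p) ?gen"
    by (simp add: coord_tvec_of_component[OF cp X_tangent[OF p]] \<omega>[OF p X_tangent[OF p] gen])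
  also have "\<dots> = f ?p * \<theta> ?p ?gen"
    by (simp add: X_eq[OF p gen] differential_invariant_generator[OF smooth_H H \<xi> p])
  also have "\<theta> ?p ?gen = ?J ?p \<xi>"
    using \<xi> by (simp add: momentum_map_def)
  finally have one: "exterior_derivative M \<theta> ?p (coord_tvec M ?c ?p (1 *\<^sub>R X ?p ?c)) ?gen =
      f ?p * ?J ?p \<xi>" .
  have "exterior_derivative M \<theta> ?p (coord_tvec M ?c ?p (r *\<^sub>R X ?p ?c)) ?gen =
      f ?p * ?J ?p \<xi> * r" for r
    using linear_cmul[OF has_derivative_linear[OF deriv], of r 1] one by simp
  with deriv show ?thesis
    by (simp add: has_field_derivative_def)
qed

lemma (in smooth_manifold) continuous_on_integral_curve:
  assumes x: "integral_curve M X I x" and f: "smooth_function M f"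
  shows "continuous_on I (\<lambda>t. f (x t))"
proof (rule continuous_at_imp_continuous_on, rule ballI)
  fix t assume t: "t \<in> I"
  have I: "open I" and cont: "continuous_map (top_of_set I) (topol M) x"
    and x': "\<And>c. c \<in> charts_at M (x t) \<Longrightarrow> ((\<lambda>s. snd c (x s)) has_vector_derivative X (x t) c) (at t)"
    using x t unfolding integral_curve_def by blast+
  have "x t \<in> points M"
    using continuous_map_funspace[OF cont] t by auto
  then have cp: "some_chart M (x t) \<in> charts_at M (x t)" (is "?c \<in> _")
    by (rule some_chart_at)
  note c = charts_atD[OF cp]
  have "(f \<circ> chart_inv ?c) differentiable (at (snd ?c (x t)))"
    using f c by (intro smooth_on_imp_differentiable[of "snd ?c ` fst ?c"])
      (auto simp: smooth_function_def)
  then have "isCont (f \<circ> chart_inv ?c) (snd ?c (x t))"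
    by (rule differentiable_imp_continuous_within)
  with has_vector_derivative_continuous[OF x'[OF cp]]
  have "isCont (\<lambda>s. (f \<circ> chart_inv ?c) (snd ?c (x s))) t"
    by (rule isCont_o2)
  moreover have "open {s \<in> I. x s \<in> fst ?c}"
    using openin_continuous_map_preimage[OF cont chart_domain_open[OF c(1)]] I
    by (simp add: openin_open_eq)
  then have "\<forall>\<^sub>F s in nhds t. s \<in> {s \<in> I. x s \<in> fst ?c}"
    by (rule eventually_nhds_in_open) (use t c in simp)
  then have "\<forall>\<^sub>F s in nhds t. (f \<circ> chart_inv ?c) (snd ?c (x s)) = f (x s)"
    by eventually_elim (use chart_inv_chart[OF c(1)] in simp)
  ultimately show "isCont (\<lambda>t. f (x t)) t"
    by (rule iffD1[OF isCont_cong, rotated])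
qed

text \<open>
  The integrating factor \<open>exp (- \<integral>g)\<close> makes \<open>exp (- \<integral>g) j\<close> constant on the interval \<open>I\<close>, also for
  negative times, where the oriented integral enters.
\<close>

lemma linear_ode_solution:
  fixes j g :: "real \<Rightarrow> real"
  assumes I: "open I" "is_interval I" and g: "continuous_on I g"
    and j: "\<And>t. t \<in> I \<Longrightarrow> (j has_real_derivative g t * j t) (at t)"
    and "0 \<in> I" "t \<in> I"
  shows "j t = exp (LBINT s=ereal 0..ereal t. g s) * j 0"
proof -
  let ?A = "\<lambda>t. LBINT s=ereal 0..ereal t. g s"
  have A: "(?A has_real_derivative g t) (at t)" if t: "t \<in> I" for t
  proof -
    obtain d where d: "d > 0" "cball t d \<subseteq> I" using I t open_contains_cball by blast
    (* A compact subinterval of I that contains 0 and has t in its interior. *)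
    define a where "a = min 0 (t - d)"
    define b where "b = max 0 (t + d)"
    have ends: "t - d \<in> I" "t + d \<in> I" using d by (auto simp: subset_eq dist_real_def)
    then have "a \<in> I" "b \<in> I" using \<open>0 \<in> I\<close> by (auto simp: a_def b_def min_def max_def)
    then have sub: "{a..b} \<subseteq> I"
      using I(2) unfolding is_interval_1 by (meson atLeastAtMost_iff subsetI)
    have ab: "a \<le> 0" "0 \<le> b" "a < t" "t < b" using d by (auto simp: a_def b_def)
    have "(?A has_vector_derivative g t) (at t within {a..b})"
      by (rule interval_integral_FTC2) (use ab sub continuous_on_subset[OF g] in auto)
    then have "(?A has_vector_derivative g t) (at t)"
      using ab by (simp add: at_within_Icc_at)
    then show ?thesis by (simp add: has_real_derivative_iff_has_vector_derivative)
  qed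
  have "((\<lambda>t. exp (- ?A t) * j t) has_real_derivative 0) (at t)" if "t \<in> I" for t
    by (rule derivative_eq_intros A[OF that] j[OF that] refl | simp)+
  then have "((\<lambda>t. exp (- ?A t) * j t) has_derivative (\<lambda>_. 0)) (at t within I)" if "t \<in> I" for t
    using that by (simp add: has_field_derivative_def has_derivative_at_withinI lambda_zero)
  then have "exp (- ?A t) * j t = exp (- ?A 0) * j 0"
    using has_derivative_zero_unique[OF is_interval_convex[OF I(2)], of "\<lambda>t. exp (- ?A t) * j t" t 0]
      assms(5,6) by blast
  then show ?thesis by (simp add: exp_minus field_simps)
qed

theorem proposition4p2:
  fixes \<G> :: "'g monoid"
    and G :: "('g, 'h::real_normed_vector) mfd"
    and M :: "('a, 'e::real_normed_vector) mfd"
    and \<Phi> :: "'g \<Rightarrow> 'a \<Rightarrow> 'a"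
    and \<theta> :: "'a \<Rightarrow> ('a, 'e) tvec \<Rightarrow> real"
    and \<omega> :: "'a \<Rightarrow> ('a, 'e) tvec \<Rightarrow> ('a, 'e) tvec \<Rightarrow> real"
    and H f :: "'a \<Rightarrow> real"
    and X :: "'a \<Rightarrow> ('a, 'e) tvec"
  assumes "lie_group \<G> G"
    and "exact_symplectic M \<theta> \<omega>"
    and "smooth_action \<G> G M \<Phi>"
    and "invariant_one_form \<G> M \<Phi> \<theta>"
    and "smooth_function M H" and "invariant_function \<G> M \<Phi> H"
    and "smooth_function M f" and "invariant_function \<G> M \<Phi> f"
    and "conformal_Hamiltonian_vf M \<theta> \<omega> f H X"
  defines "J \<equiv> momentum_map \<G> G M \<Phi> \<theta>"
  shows "invariant_vector_field \<G> M \<Phi> X \<and>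
    (\<forall>I x t. integral_curve M X I x \<longrightarrow> 0 \<in> I \<longrightarrow> t \<in> I \<longrightarrow>
       J (x t) = dual_scale \<G> G (exp (LBINT s=ereal 0..ereal t. f (x s))) (J (x 0)) \<and>
       (\<forall>\<mu>\<in>lie_algebra_dual \<G> G.
          x 0 \<in> ray_preimage \<G> G M \<Phi> \<theta> \<mu> \<longrightarrow> x t \<in> ray_preimage \<G> G M \<Phi> \<theta> \<mu>))"
proof -
  have "smooth_manifold M" using assms(2) by (simp add: exact_symplectic_def)
  then interpret lie_group_action \<G> G M \<Phi>
    using assms(1,3) by (simp add: lie_group_action_def lie_group_action_axioms_def)
  have curve: "J (x t) = dual_scale \<G> G (exp (LBINT s=ereal 0..ereal t. f (x s))) (J (x 0))"
    if x: "integral_curve M X I x" and t: "0 \<in> I" "t \<in> I" for I x t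
  proof
    fix \<xi>
    have I: "open I" "is_interval I" using x by (auto simp: integral_curve_def)
    show "J (x t) \<xi> = dual_scale \<G> G (exp (LBINT s=ereal 0..ereal t. f (x s))) (J (x 0)) \<xi>"
    proof (cases "\<xi> \<in> lie_algebra \<G> G")
      case True
      have "J (x t) \<xi> = exp (LBINT s=ereal 0..ereal t. f (x s)) * J (x 0) \<xi>"
        by (rule linear_ode_solution[OF I continuous_on_integral_curve[OF x assms(7)] _ t])
          (unfold J_def, rule momentum_map_along_integral_curve[OF assms(2,4,6,9) x _ True])
      then show ?thesis using True by (simp add: covec_scale_def)
    next
      case False
      then show ?thesis by (simp add: J_def momentum_map_def covec_scale_def)
    qed
  qed
  have ray: "x t \<in> ray_preimage \<G> G M \<Phi> \<theta> \<mu>"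
    if x: "integral_curve M X I x" and t: "0 \<in> I" "t \<in> I"
      and x0: "x 0 \<in> ray_preimage \<G> G M \<Phi> \<theta> \<mu>" for I x t \<mu>
  proof -
    let ?E = "exp (LBINT s=ereal 0..ereal t. f (x s))"
    obtain r where r: "r > 0" "J (x 0) = dual_scale \<G> G r \<mu>"
      using x0 by (auto simp: ray_preimage_def ray_def J_def)
    have "J (x t) = dual_scale \<G> G (?E * r) \<mu>"
      unfolding curve[OF x t] r(2) by (auto simp: covec_scale_def)
    then have "J (x t) \<in> ray \<G> G \<mu>"
      using r(1) unfolding ray_def by (intro CollectI exI[of _ "?E * r"]) simp
    moreover have "x t \<in> points M"
      using x t(2) continuous_map_funspace[of "top_of_set I" "topol M" x]
      by (auto simp: integral_curve_def)
    ultimately show ?thesis by (simp add: ray_preimage_def J_def)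
  qed
  show ?thesis
    using conformal_Hamiltonian_vf_invariant[OF assms(2,4,6,8,9)] curve ray by blast
qed

end
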